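(* There exists a nonzero join-irreducible subTuring degree. That is, there is a partial function $f\colon\subseteq\omega\to\omega$ with no partial computable extension such that for all partial functions $g,h$, if $f\equiv_{\rm subT} g\oplus h$ then $f\equiv_{\rm subT} g$ or $f\equiv_{\rm subT} h$.
   Context: For a partial computable function $\Phi$ from finite sequences of natural numbers to $\{0,1\}\times\omega$ and a partial function $g\colon\subseteq\omega\to\omega$, the $g$-relative sequential computation $\Phi[g]$ is defined as follows. On input $n$, with oracle answers $a_0,\dots,a_{s-1}$ obtained so far: if $\Phi(n,a_0,\dots,a_{s-1})$ is undefined, $\Phi[g](n)$ is undefined; if it equals $\langle 1,q\rangle$ the computation halts with output $q$; if it equals $\langle 0,q\rangle$, $q$ is a query, and if $q\in{\rm dom}(g)$ the computation continues with $a_s=g(q)$, while if $q\notin{\rm dom}(g)$ the computation never halts. $f\leq_{\rm subT} g$ means there is such $\Phi$ with $f\subseteq\Phi[g]$; $\equiv_{\rm subT}$ is mutual reducibility. The join is $(f\oplus g)(2n)=f(n)$, $(f\oplus g)(2n+1)=g(n)$, which is the least upper bound in the subTuring degrees. The zero degree consists of the partial functions having a partial computable extension. *)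

theory Defs
  imports Main "HOL-Library.Nat_Bijection"
begin

text \<open>
  Partial computability is Kleene's notion of a partial (\<open>\<mu>\<close>-)recursive function. Programs carry no
  arity annotation; the restriction of \<open>rec_eval r\<close> to lists of length \<open>k\<close> is the \<open>k\<close>-ary partial
  function denoted by \<open>r\<close>, and an arity mismatch just makes the value undefined.
\<close>

datatype recf =
    Zero
  | Succ
  | Proj nat
  | Comp recf "recf list"
  | PrimRec recf recf
  | Mu recf

text \<open>
  Composition is strict: all arguments must be defined. \<open>Mu r\<close> returns the least \<open>y\<close> with value \<open>0\<close>,
  provided that \<open>r\<close> is defined at all smaller arguments as well.
\<close>

primrec rec_eval :: "recf \<Rightarrow> nat list \<Rightarrow> nat option" where
  "rec_eval Zero = (\<lambda>xs. Some 0)"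
| "rec_eval Succ = (\<lambda>xs. case xs of [x] \<Rightarrow> Some (Suc x) | _ \<Rightarrow> None)"
| "rec_eval (Proj i) = (\<lambda>xs. if i < length xs then Some (xs ! i) else None)"
| "rec_eval (Comp r rs) =
     (\<lambda>xs. Option.bind (those (map (\<lambda>e. e xs) (map rec_eval rs))) (rec_eval r))"
| "rec_eval (PrimRec r s) =
     (\<lambda>xs. case xs of [] \<Rightarrow> None
        | y # ys \<Rightarrow> rec_nat (rec_eval r ys)
                     (\<lambda>k v. Option.bind v (\<lambda>u. rec_eval s (k # u # ys))) y)"
| "rec_eval (Mu r) =
     (\<lambda>xs. if \<exists>y. rec_eval r (y # xs) = Some 0 \<and> (\<forall>z<y. rec_eval r (z # xs) \<noteq> None)
           then Some (LEAST y. rec_eval r (y # xs) = Some 0) else None)"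

definition partial_computable :: "(nat \<rightharpoonup> nat) \<Rightarrow> bool" where
  "partial_computable \<phi> \<longleftrightarrow> (\<exists>r. \<forall>n. \<phi> n = rec_eval r [n])"

text \<open>
  The set \<open>{0,1} \<times> \<omega>\<close> is represented by \<^typ>\<open>bool \<times> nat\<close>: \<open>(False, q)\<close> is the query \<open>q\<close> and
  \<open>(True, q)\<close> is the output \<open>q\<close>. Finite sequences and pairs are coded by numbers in the standard way.
\<close>

definition seq_computable :: "(nat list \<rightharpoonup> bool \<times> nat) \<Rightarrow> bool" where
  "seq_computable \<Phi> \<longleftrightarrow>
     (\<exists>\<phi>. partial_computable \<phi> \<and>
       (\<forall>xs. \<phi> (list_encode xs) = map_option (\<lambda>(b, q). prod_encode (of_bool b, q)) (\<Phi> xs)))"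

text \<open>
  \<open>seq_run \<Phi> g n as y\<close>: on input \<open>n\<close>, once the answers \<open>as\<close> (in chronological order) have been
  obtained, the computation eventually halts with output \<open>y\<close>.
\<close>

inductive seq_run ::
  "(nat list \<rightharpoonup> bool \<times> nat) \<Rightarrow> (nat \<rightharpoonup> nat) \<Rightarrow> nat \<Rightarrow> nat list \<Rightarrow> nat \<Rightarrow> bool"
  for \<Phi> g n where
  halt: "\<Phi> (n # as) = Some (True, q) \<Longrightarrow> seq_run \<Phi> g n as q"
| query: "\<lbrakk>\<Phi> (n # as) = Some (False, q); g q = Some a; seq_run \<Phi> g n (as @ [a]) y\<rbrakk>
          \<Longrightarrow> seq_run \<Phi> g n as y"

definition seq_comp :: "(nat list \<rightharpoonup> bool \<times> nat) \<Rightarrow> (nat \<rightharpoonup> nat) \<Rightarrow> (nat \<rightharpoonup> nat)" where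
  "seq_comp \<Phi> g =
     (\<lambda>n. if \<exists>y. seq_run \<Phi> g n [] y then Some (THE y. seq_run \<Phi> g n [] y) else None)"

lemma seq_run_functional:
  assumes "seq_run \<Phi> g n as y" and "seq_run \<Phi> g n as y'"
  shows "y = y'"
  using assms
proof (induction arbitrary: y' rule: seq_run.induct)
  case (halt as q)
  from halt(2) show ?case
  proof cases
    case halt
    with \<open>\<Phi> (n # as) = Some (True, q)\<close> show ?thesis by simp
  next
    case (query q' a')
    with \<open>\<Phi> (n # as) = Some (True, q)\<close> show ?thesis by simp
  qed
next
  case (query as q a y)
  from query.prems show ?case
  proof cases
    case halt
    with query.hyps(1) show ?thesis by simp
  next
    case (query q' a')
    with \<open>\<Phi> (n # as) = Some (False, q)\<close> \<open>g q = Some a\<close> have "a' = a" by simp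
    with query(3) have "seq_run \<Phi> g n (as @ [a]) y'" by simp
    then show ?thesis by (rule \<open>\<And>y'. seq_run \<Phi> g n (as @ [a]) y' \<Longrightarrow> y = y'\<close>)
  qed
qed

lemma seq_comp_eq_Some_iff: "seq_comp \<Phi> g n = Some y \<longleftrightarrow> seq_run \<Phi> g n [] y"
proof -
  have the: "(THE y. seq_run \<Phi> g n [] y) = z" if "seq_run \<Phi> g n [] z" for z
    using that by (rule the_equality) (rule seq_run_functional[OF _ that])
  show ?thesis
  proof (cases "\<exists>z. seq_run \<Phi> g n [] z")
    case True
    then obtain z where z: "seq_run \<Phi> g n [] z" ..
    then have "seq_comp \<Phi> g n = Some z"
      using True by (simp only: seq_comp_def the[OF z] if_True)
    moreover have "seq_run \<Phi> g n [] y \<longleftrightarrow> y = z"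
      using z seq_run_functional[OF z] by blast
    ultimately show ?thesis by (simp only: option.inject eq_commute[of z])
  next
    case False
    then have "seq_comp \<Phi> g n = None" by (simp only: seq_comp_def if_False)
    with False show ?thesis by auto
  qed
qed

definition subT_le :: "(nat \<rightharpoonup> nat) \<Rightarrow> (nat \<rightharpoonup> nat) \<Rightarrow> bool" (infix "\<le>\<^sub>s\<^sub>u\<^sub>b\<^sub>T" 50) where
  "f \<le>\<^sub>s\<^sub>u\<^sub>b\<^sub>T g \<longleftrightarrow> (\<exists>\<Phi>. seq_computable \<Phi> \<and> f \<subseteq>\<^sub>m seq_comp \<Phi> g)"

definition subT_equiv :: "(nat \<rightharpoonup> nat) \<Rightarrow> (nat \<rightharpoonup> nat) \<Rightarrow> bool" (infix "\<equiv>\<^sub>s\<^sub>u\<^sub>b\<^sub>T" 50) where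
  "f \<equiv>\<^sub>s\<^sub>u\<^sub>b\<^sub>T g \<longleftrightarrow> f \<le>\<^sub>s\<^sub>u\<^sub>b\<^sub>T g \<and> g \<le>\<^sub>s\<^sub>u\<^sub>b\<^sub>T f"

definition join :: "(nat \<rightharpoonup> nat) \<Rightarrow> (nat \<rightharpoonup> nat) \<Rightarrow> (nat \<rightharpoonup> nat)" (infixl "\<oplus>" 65) where
  "f \<oplus> g = (\<lambda>m. if even m then f (m div 2) else g (m div 2))"

end

theory Submission
  imports Defs "HOL-Library.Countable"
begin

text \<open>
  The function \<open>f\<close> is built by finite extension with a shrinking reservoir: a condition \<open>(p, X)\<close>
  promises that \<open>f\<close> extends the finite 0-1-valued \<open>p\<close> and that new arguments come from the infinite
  set \<open>X\<close>. Suppose \<open>f \<subseteq> \<Theta>[g \<oplus> h]\<close> and \<open>g \<oplus> h \<subseteq> \<Lambda>[f]\<close>, and consider the runs of \<open>\<Theta>[\<Lambda>[p(n \<mapsto> b)]]\<close> on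
  \<open>n \<in> X\<close> for \<open>b = 0, 1\<close>. If one of them does not output \<open>b\<close>, put \<open>f n = b\<close>; the run is
  deterministic, so if it is stuck at an unanswered query, then deleting this single query from \<open>X\<close>
  keeps it stuck for ever and refutes \<open>f \<subseteq> \<Theta>[\<Lambda>[f]]\<close>. Otherwise the two runs have different outputs,
  so there is a first query of \<open>\<Theta>\<close> that they answer differently. It can be found effectively from
  \<open>n\<close> and \<open>p\<close>, and its true answer reveals \<open>f n\<close>. According to whether this query is addressed to
  \<open>g\<close> or to \<open>h\<close>, \<open>X\<close> splits into two parts; keeping an infinite one makes \<open>f\<close> reducible to \<open>g\<close> or
  to \<open>h\<close>. The reservoirs need not be computable.
\<close>

section \<open>Closure properties of the partial recursive functions\<close>

text \<open>The arity \<open>k\<close> is fixed from outside because programs carry none. Values at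
  lists of other lengths are left open, so \<open>F\<close> may be written freely with
  \<open>!\<close>, \<open>hd\<close> and \<open>tl\<close>.\<close>

definition rec_fun :: "nat \<Rightarrow> (nat list \<rightharpoonup> nat) \<Rightarrow> bool" where
  "rec_fun k F \<longleftrightarrow> (\<exists>r. \<forall>xs. length xs = k \<longrightarrow> rec_eval r xs = F xs)"

definition total_rec :: "nat \<Rightarrow> (nat list \<Rightarrow> nat) \<Rightarrow> bool" where
  "total_rec k F \<longleftrightarrow> rec_fun k (\<lambda>xs. Some (F xs))"

lemma rec_fun_cong:
  assumes "rec_fun k F" and "\<And>xs. length xs = k \<Longrightarrow> F xs = G xs"
  shows "rec_fun k G"
  using assms unfolding rec_fun_def by metis

lemma total_rec_cong:
  assumes "total_rec k F" and "\<And>xs. length xs = k \<Longrightarrow> F xs = G xs"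
  shows "total_rec k G"
  using assms(1) unfolding total_rec_def by (rule rec_fun_cong) (simp add: assms(2))

lemma rec_fun_Some: "total_rec k F \<Longrightarrow> rec_fun k (\<lambda>xs. Some (F xs))"
  by (simp add: total_rec_def)

lemma partial_computable_iff_rec_fun:
  "partial_computable \<phi> \<longleftrightarrow> rec_fun 1 (\<lambda>xs. \<phi> (xs ! 0))"
proof
  assume "partial_computable \<phi>"
  then obtain r where "\<And>n. \<phi> n = rec_eval r [n]"
    by (auto simp: partial_computable_def)
  then show "rec_fun 1 (\<lambda>xs. \<phi> (xs ! 0))"
    unfolding rec_fun_def by (intro exI[of _ r]) (auto simp: length_Suc_conv)
next
  assume "rec_fun 1 (\<lambda>xs. \<phi> (xs ! 0))"
  then obtain r where "\<And>xs. length xs = 1 \<Longrightarrow> rec_eval r xs = \<phi> (xs ! 0)"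
    by (auto simp: rec_fun_def)
  from this[of "[n]" for n] show "partial_computable \<phi>"
    unfolding partial_computable_def by (intro exI[of _ r]) simp
qed

lemma those_map_Some: "those (map Some xs) = Some xs"
  by (induction xs) auto

text \<open>With total inner functions the strictness of \<open>Comp\<close> is harmless:
  \<open>those\<close> always yields the full list of arguments.\<close>

lemma rec_fun_subst:
  assumes F: "rec_fun (length As) F" and As: "\<And>A. A \<in> set As \<Longrightarrow> total_rec k A"
  shows "rec_fun k (\<lambda>xs. F (map (\<lambda>A. A xs) As))"
proof -
  have "\<exists>rs. \<forall>xs. length xs = k \<longrightarrow> map (\<lambda>r. rec_eval r xs) rs = map (\<lambda>A. Some (A xs)) As"
    using As
  proof (induction As)
    case (Cons A As)
    then obtain rs where rs: "\<And>xs. length xs = k \<Longrightarrow>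
        map (\<lambda>r. rec_eval r xs) rs = map (\<lambda>A. Some (A xs)) As"
      by auto
    from Cons.prems[of A] obtain r where "\<And>xs. length xs = k \<Longrightarrow> rec_eval r xs = Some (A xs)"
      by (auto simp: total_rec_def rec_fun_def)
    with rs show ?case by (intro exI[of _ "r # rs"]) simp
  qed simp
  then obtain rs where rs: "\<And>xs. length xs = k \<Longrightarrow>
      map (\<lambda>r. rec_eval r xs) rs = map Some (map (\<lambda>A. A xs) As)"
    by (auto simp: o_def)
  from F obtain r where r: "\<And>xs. length xs = length As \<Longrightarrow> rec_eval r xs = F xs"
    by (auto simp: rec_fun_def)
  have "rec_eval (Comp r rs) xs = F (map (\<lambda>A. A xs) As)" if "length xs = k" for xs
  proof -
    have "rec_eval (Comp r rs) xs = Option.bind (those (map (\<lambda>r. rec_eval r xs) rs)) (rec_eval r)"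
      by (simp add: o_def)
    then show ?thesis
      unfolding rs[OF that] those_map_Some by (simp add: r)
  qed
  then show ?thesis unfolding rec_fun_def by blast
qed

lemma total_rec_subst:
  assumes "total_rec (length As) F" and "\<And>A. A \<in> set As \<Longrightarrow> total_rec k A"
  shows "total_rec k (\<lambda>xs. F (map (\<lambda>A. A xs) As))"
  using assms unfolding total_rec_def[of _ F] total_rec_def[of _ "\<lambda>xs. F (map (\<lambda>A. A xs) As)"]
  by (rule rec_fun_subst)

lemma rec_fun_subst1:
  "rec_fun 1 F \<Longrightarrow> total_rec k A \<Longrightarrow> rec_fun k (\<lambda>xs. F [A xs])"
  using rec_fun_subst[of "[A]" F k] by simp

lemma rec_fun_subst2:
  "rec_fun 2 F \<Longrightarrow> total_rec k A \<Longrightarrow> total_rec k B \<Longrightarrow> rec_fun k (\<lambda>xs. F [A xs, B xs])"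
  using rec_fun_subst[of "[A, B]" F k] by (auto simp: numeral_2_eq_2)

lemma rec_fun_subst3:
  "rec_fun 3 F \<Longrightarrow> total_rec k A \<Longrightarrow> total_rec k B \<Longrightarrow> total_rec k C \<Longrightarrow>
    rec_fun k (\<lambda>xs. F [A xs, B xs, C xs])"
  using rec_fun_subst[of "[A, B, C]" F k] by (auto simp: numeral_3_eq_3)

lemma total_rec_subst1:
  "total_rec 1 (\<lambda>xs. h (xs ! 0)) \<Longrightarrow> total_rec k A \<Longrightarrow> total_rec k (\<lambda>xs. h (A xs))"
  using total_rec_subst[of "[A]" "\<lambda>xs. h (xs ! 0)" k] by simp

lemma total_rec_subst2:
  "total_rec 2 (\<lambda>xs. h (xs ! 0) (xs ! 1)) \<Longrightarrow> total_rec k A \<Longrightarrow> total_rec k B \<Longrightarrow>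
    total_rec k (\<lambda>xs. h (A xs) (B xs))"
  using total_rec_subst[of "[A, B]" "\<lambda>xs. h (xs ! 0) (xs ! 1)" k] by (auto simp: numeral_2_eq_2)

named_theorems total_rec_intros

lemma total_rec_nth [total_rec_intros]: "i < k \<Longrightarrow> total_rec k (\<lambda>xs. xs ! i)"
  unfolding total_rec_def rec_fun_def by (intro exI[of _ "Proj i"]) simp

lemma total_rec_Suc [total_rec_intros]:
  assumes "total_rec k A" shows "total_rec k (\<lambda>xs. Suc (A xs))"
proof (rule total_rec_subst1[OF _ assms])
  show "total_rec 1 (\<lambda>xs. Suc (xs ! 0))"
    unfolding total_rec_def rec_fun_def
    by (intro exI[of _ Succ]) (auto simp: length_Suc_conv)
qed

lemma total_rec_const [total_rec_intros]: "total_rec k (\<lambda>xs. c)"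
proof (induction c)
  case 0
  show ?case unfolding total_rec_def rec_fun_def by (intro exI[of _ Zero]) simp
next
  case (Suc c)
  then show ?case by (rule total_rec_Suc)
qed

text \<open>Sequencing with a partial first step. Its result is pushed in front of the unchanged
  arguments, as for a de Bruijn binder, so argument indices in \<open>B\<close> are shifted by
  one.\<close>

lemma rec_fun_let:
  assumes A: "rec_fun k A" and B: "rec_fun (Suc k) B"
  shows "rec_fun k (\<lambda>xs. Option.bind (A xs) (\<lambda>a. B (a # xs)))"
proof -
  from A obtain r where r: "\<And>xs. length xs = k \<Longrightarrow> rec_eval r xs = A xs"
    by (auto simp: rec_fun_def)
  from B obtain s where s: "\<And>xs. length xs = Suc k \<Longrightarrow> rec_eval s xs = B xs"
    by (auto simp: rec_fun_def)
  have "rec_eval (Comp s (r # map Proj [0..<k])) xs = Option.bind (A xs) (\<lambda>a. B (a # xs))"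
    if len: "length xs = k" for xs
  proof -
    have proj: "map (\<lambda>e. e xs) (map rec_eval (map Proj [0..<k])) = map Some xs"
      using len by (intro nth_equalityI) auto
    have "rec_eval (Comp s (r # map Proj [0..<k])) xs =
        Option.bind (case rec_eval r xs of None \<Rightarrow> None
          | Some y \<Rightarrow> map_option ((#) y) (those (map Some xs))) (rec_eval s)"
      unfolding proj[symmetric] by (simp only: rec_eval.simps list.map those.simps)
    then show ?thesis
      by (auto simp: those_map_Some r s len split: option.split)
  qed
  then show ?thesis unfolding rec_fun_def by blast
qed

lemma rec_fun_bind:
  assumes "rec_fun 1 (\<lambda>xs. \<phi> (xs ! 0))" and "rec_fun k A"
  shows "rec_fun k (\<lambda>xs. Option.bind (A xs) \<phi>)"
  using rec_fun_let[OF assms(2) rec_fun_subst1[OF assms(1) total_rec_nth[of 0 "Suc k"]]] by simp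

lemma rec_fun_primrec:
  assumes A: "rec_fun k A" and B: "rec_fun (Suc (Suc k)) B"
  shows "rec_fun (Suc k) (\<lambda>xs. rec_nat (A (tl xs))
    (\<lambda>i v. Option.bind v (\<lambda>u. B (i # u # tl xs))) (hd xs))"
proof -
  from A obtain r where r: "\<And>xs. length xs = k \<Longrightarrow> rec_eval r xs = A xs"
    by (auto simp: rec_fun_def)
  from B obtain s where s: "\<And>xs. length xs = Suc (Suc k) \<Longrightarrow> rec_eval s xs = B xs"
    by (auto simp: rec_fun_def)
  show ?thesis
    unfolding rec_fun_def by (intro exI[of _ "PrimRec r s"]) (auto simp: length_Suc_conv r s)
qed

lemma total_rec_primrec:
  assumes A: "total_rec k A" and B: "total_rec (Suc (Suc k)) B"
  shows "total_rec (Suc k) (\<lambda>xs. rec_nat (A (tl xs)) (\<lambda>i u. B (i # u # tl xs)) (hd xs))"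
proof -
  have "rec_nat (Some a) (\<lambda>i v. Option.bind v (\<lambda>u. Some (C i u))) n = Some (rec_nat a C n)"
    for a n and C :: "nat \<Rightarrow> nat \<Rightarrow> nat"
    by (induction n) auto
  then show ?thesis
    using rec_fun_primrec[OF A[unfolded total_rec_def] B[unfolded total_rec_def]]
    by (simp add: total_rec_def)
qed

lemma rec_fun_Mu:
  assumes "rec_fun (Suc k) F"
  shows "rec_fun k (\<lambda>xs. if \<exists>y. F (y # xs) = Some 0 \<and> (\<forall>z<y. F (z # xs) \<noteq> None)
    then Some (LEAST y. F (y # xs) = Some 0) else None)"
proof -
  from assms obtain r where "\<And>xs. length xs = Suc k \<Longrightarrow> rec_eval r xs = F xs"
    by (auto simp: rec_fun_def)
  then show ?thesis
    unfolding rec_fun_def by (intro exI[of _ "Mu r"]) (simp cong: conj_cong if_cong)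
qed

lemma total_rec_Least:
  assumes "total_rec (Suc k) F" and "\<And>xs. \<exists>y. F (y # xs) = 0"
  shows "total_rec k (\<lambda>xs. LEAST y. F (y # xs) = 0)"
  using rec_fun_Mu[OF assms(1)[unfolded total_rec_def]] assms(2) by (simp add: total_rec_def)

text \<open>Minimisation of the constant 1 never finds a zero.\<close>

lemma rec_fun_None: "rec_fun k (\<lambda>xs. None)"
  using rec_fun_Mu[OF total_rec_const[of "Suc k" 1, unfolded total_rec_def]] by simp

section \<open>Arithmetic, case distinction and pairing\<close>

lemma total_rec_add [total_rec_intros]:
  assumes "total_rec k A" "total_rec k B" shows "total_rec k (\<lambda>xs. A xs + B xs)"
proof (rule total_rec_subst2[OF _ assms])
  have rec: "rec_nat y (\<lambda>i u. Suc u) x = x + y" for x y :: nat by (induction x) auto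
  have "total_rec (Suc 1) (\<lambda>xs. rec_nat (tl xs ! 0) (\<lambda>i u. Suc ((i # u # tl xs) ! 1)) (hd xs))"
    by (intro total_rec_primrec total_rec_intros) auto
  then show "total_rec 2 (\<lambda>xs. xs ! 0 + xs ! 1)"
    unfolding Suc_1 by (rule total_rec_cong) (auto simp: rec length_Suc_conv numeral_2_eq_2)
qed

lemma total_rec_pred [total_rec_intros]:
  assumes "total_rec k A" shows "total_rec k (\<lambda>xs. A xs - 1)"
proof (rule total_rec_subst1[OF _ assms])
  have rec: "rec_nat 0 (\<lambda>i u. i) x = x - 1" for x :: nat by (cases x) auto
  have "total_rec (Suc 0) (\<lambda>xs. rec_nat 0 (\<lambda>i u. (i # u # tl xs) ! 0) (hd xs))"
    by (intro total_rec_primrec total_rec_intros) auto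
  then show "total_rec 1 (\<lambda>xs. xs ! 0 - 1)"
    unfolding One_nat_def by (rule total_rec_cong) (auto simp: rec length_Suc_conv)
qed

lemma total_rec_diff [total_rec_intros]:
  assumes "total_rec k A" "total_rec k B" shows "total_rec k (\<lambda>xs. A xs - B xs)"
proof (rule total_rec_subst2[of "\<lambda>b a. a - b", OF _ assms(2,1)])
  have rec: "rec_nat y (\<lambda>i u. u - 1) x = y - x" for x y :: nat by (induction x) auto
  have "total_rec (Suc 1) (\<lambda>xs. rec_nat (tl xs ! 0) (\<lambda>i u. (i # u # tl xs) ! 1 - 1) (hd xs))"
    by (intro total_rec_primrec total_rec_intros) auto
  then show "total_rec 2 (\<lambda>xs. xs ! 1 - xs ! 0)"
    unfolding Suc_1
    by (rule total_rec_cong) (auto simp: rec[simplified] length_Suc_conv numeral_2_eq_2)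
qed

lemma total_rec_half [total_rec_intros]:
  assumes "total_rec k A" shows "total_rec k (\<lambda>xs. A xs div 2)"
proof (rule total_rec_subst1[OF _ assms])
  \<comment> \<open>The recursion rests on \<open>Suc i div 2 = i - i div 2\<close>.\<close>
  have rec: "rec_nat 0 (\<lambda>i u. i - u) x = x div 2" for x :: nat by (induction x) auto
  have "total_rec (Suc 0)
      (\<lambda>xs. rec_nat 0 (\<lambda>i u. (i # u # tl xs) ! 0 - (i # u # tl xs) ! 1) (hd xs))"
    by (intro total_rec_primrec total_rec_intros) auto
  then show "total_rec 1 (\<lambda>xs. xs ! 0 div 2)"
    unfolding One_nat_def by (rule total_rec_cong) (auto simp: rec length_Suc_conv)
qed

lemma total_rec_triangle [total_rec_intros]:
  assumes "total_rec k A" shows "total_rec k (\<lambda>xs. triangle (A xs))"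
proof (rule total_rec_subst1[OF _ assms])
  have rec: "rec_nat 0 (\<lambda>i u. u + Suc i) x = triangle x" for x :: nat by (induction x) auto
  have "total_rec (Suc 0)
      (\<lambda>xs. rec_nat 0 (\<lambda>i u. (i # u # tl xs) ! 1 + Suc ((i # u # tl xs) ! 0)) (hd xs))"
    by (intro total_rec_primrec total_rec_intros) auto
  then show "total_rec 1 (\<lambda>xs. triangle (xs ! 0))"
    unfolding One_nat_def by (rule total_rec_cong) (auto simp: rec[simplified] length_Suc_conv)
qed

lemma rec_fun_proj:
  assumes "rec_fun (length is) F" and "\<And>i. i \<in> set is \<Longrightarrow> i < k"
  shows "rec_fun k (\<lambda>xs. F (map ((!) xs) is))"
proof -
  have "rec_fun k (\<lambda>xs. F (map (\<lambda>A. A xs) (map (\<lambda>i xs. xs ! i) is)))"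
    using assms by (intro rec_fun_subst) (auto intro: total_rec_nth)
  then show ?thesis by (simp add: o_def)
qed

lemma map_nth_upt: "length xs = m + k \<Longrightarrow> map ((!) xs) [m..<m + k] = drop m xs"
  by (intro nth_equalityI) auto

text \<open>The branch \<open>B\<close> is evaluated only if the guard is nonzero: primitive recursion on the guard
  starts with the total branch \<open>A\<close> and overwrites it.\<close>

lemma rec_fun_if:
  assumes c: "total_rec k c" and A: "total_rec k A" and B: "rec_fun k B"
  shows "rec_fun k (\<lambda>xs. if c xs = 0 then Some (A xs) else B xs)"
proof -
  have rec: "rec_nat (Some a) (\<lambda>i v. Option.bind v (\<lambda>u. b)) n = (if n = 0 then Some a else b)"
    for a n and b :: "nat option"
    by (induction n) (cases b; simp)+
  have "rec_fun (Suc (Suc k)) (\<lambda>xs. B (drop 2 xs))"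
  proof (rule rec_fun_cong)
    show "rec_fun (Suc (Suc k)) (\<lambda>xs. B (map ((!) xs) [2..<2 + k]))"
      using B by (intro rec_fun_proj) (auto simp del: upt_Suc)
  qed (subst map_nth_upt; simp)
  from rec_fun_let[OF rec_fun_Some[OF c] rec_fun_primrec[OF rec_fun_Some[OF A] this]]
  show ?thesis by (simp add: rec)
qed

lemma total_rec_if [total_rec_intros]:
  assumes "total_rec k c" "total_rec k A" "total_rec k B"
  shows "total_rec k (\<lambda>xs. if c xs = 0 then A xs else B xs)"
  using rec_fun_if[OF assms(1,2) rec_fun_Some[OF assms(3)]]
  unfolding total_rec_def by (rule rec_fun_cong) simp

lemma eq_iff_diffs: "x = y \<longleftrightarrow> (x - y) + (y - x) = (0::nat)" by auto

lemma total_rec_if_eq [total_rec_intros]: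
  assumes "total_rec k C" "total_rec k D" "total_rec k A" "total_rec k B"
  shows "total_rec k (\<lambda>xs. if C xs = D xs then A xs else B xs)"
  unfolding eq_iff_diffs[of "C _"] by (intro total_rec_intros assms)

lemma total_rec_prod_encode [total_rec_intros]:
  assumes "total_rec k A" "total_rec k B" shows "total_rec k (\<lambda>xs. prod_encode (A xs, B xs))"
  unfolding prod_encode_def case_prod_conv by (intro total_rec_intros assms)

lemma triangle_ge: "n \<le> triangle n" by (induction n) auto

text \<open>Since \<open>prod_encode (a, b) = triangle (a + b) + a\<close>, the diagonal
  \<open>a + b\<close> is the largest \<open>s\<close> with \<open>triangle s \<le> m\<close>, hence
  the least one with \<open>m < triangle (Suc s)\<close>. Truncated subtraction turns this
  inequality into a zero test fit for minimisation.\<close>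

lemma prod_decode_eq_Least:
  fixes m :: nat
  defines "s \<equiv> LEAST s. Suc m - triangle (Suc s) = 0"
  shows "prod_decode m = (m - triangle s, s - (m - triangle s))"
proof -
  obtain a b where ab: "prod_decode m = (a, b)" by force
  then have "m = prod_encode (a, b)" using prod_decode_inverse[of m] by simp
  then have m: "m = triangle (a + b) + a" by (simp add: prod_encode_def)
  have mono: "triangle x \<le> triangle y" if "x \<le> y" for x y
    using that by (induction rule: dec_induct) auto
  have "s = a + b" unfolding s_def
  proof (rule Least_equality)
    show "Suc m - triangle (Suc (a + b)) = 0" by (simp add: m)
    fix y assume *: "Suc m - triangle (Suc y) = 0"
    show "a + b \<le> y"
    proof (rule ccontr)
      assume "\<not> a + b \<le> y"
      then have "triangle (Suc y) \<le> triangle (a + b)" by (intro mono) simp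
      with * m show False by simp
    qed
  qed
  moreover have "m - triangle (a + b) = a" using m by simp
  ultimately show ?thesis by (simp add: ab)
qed

lemma total_rec_diagonal:
  assumes "total_rec k A"
  shows "total_rec k (\<lambda>xs. LEAST s. Suc (A xs) - triangle (Suc s) = 0)"
proof (rule total_rec_subst1[of "\<lambda>m. LEAST s. Suc m - triangle (Suc s) = 0", OF _ assms])
  have "total_rec (Suc 1) (\<lambda>xs. Suc (xs ! 1) - triangle (Suc (xs ! 0)))"
    by (intro total_rec_intros) auto
  \<comment> \<open>The number being decoded bounds its own diagonal, which makes the search
    total.\<close>
  moreover have "\<exists>y. Suc ((y # xs) ! 1) - triangle (Suc ((y # xs) ! 0)) = 0" for xs
    by (intro exI[of _ "xs ! 0"]) (simp add: triangle_ge)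
  ultimately have "total_rec 1 (\<lambda>xs. LEAST s. Suc ((s # xs) ! 1) - triangle (Suc ((s # xs) ! 0)) = 0)"
    by (rule total_rec_Least)
  then show "total_rec 1 (\<lambda>xs. LEAST s. Suc (xs ! 0) - triangle (Suc s) = 0)"
    by simp
qed

lemma total_rec_fst_decode [total_rec_intros]:
  assumes "total_rec k A" shows "total_rec k (\<lambda>xs. fst (prod_decode (A xs)))"
  unfolding prod_decode_eq_Least fst_conv
  by (intro total_rec_intros total_rec_diagonal assms)

lemma total_rec_snd_decode [total_rec_intros]:
  assumes "total_rec k A" shows "total_rec k (\<lambda>xs. snd (prod_decode (A xs)))"
  unfolding prod_decode_eq_Least snd_conv
  by (intro total_rec_intros total_rec_diagonal assms)

section \<open>Codes of lists\<close>

lemma length_le_list_encode: "length xs \<le> list_encode xs"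
proof (induction xs)
  case (Cons x xs)
  then show ?case using le_prod_encode_2[of "list_encode xs" x] by simp
qed simp

text \<open>A nonempty list has code \<open>Suc (prod_encode (x, c))\<close>, with \<open>c\<close>
  the code of its tail, and the empty list has code 0. Truncation in \<open>l - 1\<close> makes head
  and tail of the empty list default to 0.\<close>

definition code_hd :: "nat \<Rightarrow> nat" where
  "code_hd l = fst (prod_decode (l - 1))"

definition code_tl :: "nat \<Rightarrow> nat" where
  "code_tl l = snd (prod_decode (l - 1))"

definition code_rev :: "nat \<Rightarrow> nat" where
  "code_rev l = list_encode (rev (list_decode l))"

definition code_snoc :: "nat \<Rightarrow> nat \<Rightarrow> nat" where
  "code_snoc l a = list_encode (list_decode l @ [a])"

lemma prod_decode_0 [simp]: "prod_decode 0 = (0, 0)"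
  by (simp add: prod_decode_def prod_decode_aux.simps)

lemma code_simps [simp]:
  "code_hd 0 = 0" "code_hd (Suc m) = fst (prod_decode m)"
  "code_tl 0 = 0" "code_tl (Suc m) = snd (prod_decode m)"
  "code_snoc (list_encode xs) a = list_encode (xs @ [a])"
  by (simp_all add: code_hd_def code_tl_def code_snoc_def)

lemma total_rec_code_hd [total_rec_intros]:
  "total_rec k A \<Longrightarrow> total_rec k (\<lambda>xs. code_hd (A xs))"
  unfolding code_hd_def by (intro total_rec_intros)

lemma total_rec_code_tl [total_rec_intros]:
  "total_rec k A \<Longrightarrow> total_rec k (\<lambda>xs. code_tl (A xs))"
  unfolding code_tl_def by (intro total_rec_intros)

lemma code_tl_list_encode: "code_tl (list_encode xs) = list_encode (tl xs)"
  by (cases xs) auto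

lemma code_tl_funpow: "(code_tl ^^ i) (list_encode xs) = list_encode (drop i xs)"
  by (induction i) (auto simp: code_tl_list_encode drop_Suc simp flip: tl_drop)

lemma total_rec_code_tl_funpow:
  assumes "total_rec k A" "total_rec k B" shows "total_rec k (\<lambda>xs. (code_tl ^^ A xs) (B xs))"
proof (rule total_rec_subst2[of "\<lambda>a b. (code_tl ^^ a) b", OF _ assms])
  have rec: "rec_nat y (\<lambda>i. code_tl) x = (code_tl ^^ x) y" for x y :: nat by (induction x) auto
  have "total_rec (Suc 1) (\<lambda>xs. rec_nat (tl xs ! 0) (\<lambda>i u. code_tl ((i # u # tl xs) ! 1)) (hd xs))"
    by (intro total_rec_primrec total_rec_intros) auto
  then show "total_rec 2 (\<lambda>xs. (code_tl ^^ (xs ! 0)) (xs ! 1))"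
    unfolding Suc_1
    by (rule total_rec_cong) (auto simp: rec[simplified] length_Suc_conv numeral_2_eq_2)
qed

lemma total_rec_code_rev [total_rec_intros]:
  assumes "total_rec k A" shows "total_rec k (\<lambda>xs. code_rev (A xs))"
proof (rule total_rec_subst1[OF _ assms])
  \<comment> \<open>One step of reversal: the head of the \<open>i\<close>-th tail of
    \<open>l\<close> is consed onto the accumulator \<open>u\<close>; once the list is exhausted,
    \<open>u\<close> is kept.\<close>
  define B where "B l i u = (if (code_tl ^^ i) l = 0 then u
      else Suc (prod_encode (code_hd ((code_tl ^^ i) l), u)))" for l i u
  have rec: "rec_nat 0 (B (list_encode xs)) i = list_encode (rev (take i xs))" for i xs
  proof (induction i)
    case (Suc i)
    have "list_encode (drop i xs) = 0 \<longleftrightarrow> drop i xs = []"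
      using list_encode_eq[of _ "[]"] by simp
    then show ?case
    proof (cases "i < length xs")
      case True
      then have "drop i xs = xs ! i # drop (Suc i) xs" by (simp add: Cons_nth_drop_Suc)
      with True Suc show ?thesis
        by (simp add: B_def code_tl_funpow take_Suc_conv_app_nth)
    next
      case False
      with Suc show ?thesis by (simp add: B_def code_tl_funpow)
    qed
  qed simp
  have "total_rec (Suc 1) (\<lambda>xs. rec_nat 0 (\<lambda>i u.
      if (code_tl ^^ ((i # u # tl xs) ! 0)) ((i # u # tl xs) ! 2) = 0 then (i # u # tl xs) ! 1
      else Suc (prod_encode (code_hd ((code_tl ^^ ((i # u # tl xs) ! 0)) ((i # u # tl xs) ! 2)),
        (i # u # tl xs) ! 1))) (hd xs))"
    by (intro total_rec_primrec total_rec_intros total_rec_code_tl_funpow) auto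
  then have "rec_fun 2 (\<lambda>xs. Some (rec_nat 0 (B (xs ! 1)) (xs ! 0)))"
    unfolding Suc_1 total_rec_def
    by (rule rec_fun_cong) (auto simp: B_def[abs_def] length_Suc_conv numeral_2_eq_2 cong: if_cong)
  from rec_fun_subst2[OF this, of 1 "\<lambda>xs. xs ! 0" "\<lambda>xs. xs ! 0"]
  have "total_rec 1 (\<lambda>xs. rec_nat 0 (B (xs ! 0)) (xs ! 0))"
    by (simp add: total_rec_def total_rec_nth[unfolded total_rec_def])
  \<comment> \<open>The code itself serves as the number of steps: it is at least the length of the
    list, and surplus steps change nothing.\<close>
  moreover have "rec_nat 0 (B l) l = code_rev l" for l
    using rec[of "list_decode l" l] length_le_list_encode[of "list_decode l"]
    by (simp add: code_rev_def)
  ultimately show "total_rec 1 (\<lambda>xs. code_rev (xs ! 0))" by simp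
qed

text \<open>Appending is consing between two reversals. This operation extends the history of a run
  by a new answer.\<close>

lemma total_rec_code_snoc [total_rec_intros]:
  assumes "total_rec k A" "total_rec k B" shows "total_rec k (\<lambda>xs. code_snoc (A xs) (B xs))"
proof -
  have "code_snoc l a = code_rev (Suc (prod_encode (a, code_rev l)))" for l a
    by (simp add: code_snoc_def code_rev_def)
  then show ?thesis by (simp only:) (intro total_rec_intros assms)
qed

text \<open>A finite map is a nested equality test on its finitely many arguments. The shift by
  \<open>Suc\<close> reserves 0 for undefined arguments.\<close>

lemma total_rec_finite_map:
  assumes "finite (dom p)" and "total_rec k A"
  shows "total_rec k (\<lambda>xs. case p (A xs) of None \<Rightarrow> 0 | Some v \<Rightarrow> Suc v)"
  using assms(1)
proof (induction p rule: finite_Map_induct)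
  case empty
  show ?case by (simp add: total_rec_const)
next
  case (update m v p)
  have "total_rec k (\<lambda>xs. if A xs = m then Suc v
      else case p (A xs) of None \<Rightarrow> 0 | Some v \<Rightarrow> Suc v)"
    by (intro total_rec_if_eq total_rec_const assms(2) update)
  then show ?case by (rule total_rec_cong) simp
qed

section \<open>Loops\<close>

text \<open>A while loop with partial test and partial body. Both simulations below, running a
  computation on a finite oracle and searching for a first difference, have this shape.\<close>

inductive loop :: "(nat \<rightharpoonup> nat) \<Rightarrow> (nat \<rightharpoonup> nat) \<Rightarrow> nat \<Rightarrow> nat \<Rightarrow> bool" for \<tau> \<sigma> where
  stop: "\<tau> s = Some 0 \<Longrightarrow> loop \<tau> \<sigma> s s"
| step: "\<lbrakk>\<tau> s = Some (Suc i); \<sigma> s = Some s'; loop \<tau> \<sigma> s' t\<rbrakk> \<Longrightarrow> loop \<tau> \<sigma> s t"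

definition iter :: "(nat \<rightharpoonup> nat) \<Rightarrow> nat \<Rightarrow> (nat \<rightharpoonup> nat)" where
  "iter \<sigma> T s = rec_nat (Some s) (\<lambda>i v. Option.bind v \<sigma>) T"

lemma iter_0 [simp]: "iter \<sigma> 0 s = Some s"
  by (simp add: iter_def)

lemma iter_Suc: "\<sigma> s = Some s' \<Longrightarrow> iter \<sigma> (Suc T) s = iter \<sigma> T s'"
  by (induction T) (simp_all add: iter_def)

text \<open>These are the data that \<open>Mu\<close> asks for: before round \<open>T\<close> the
  test is defined and nonzero, at \<open>T\<close> it is zero.\<close>

lemma loop_imp_iter:
  "loop \<tau> \<sigma> s t \<Longrightarrow> \<exists>T. iter \<sigma> T s = Some t \<and> \<tau> t = Some 0 \<and>
    (\<forall>z<T. \<exists>i. Option.bind (iter \<sigma> z s) \<tau> = Some (Suc i))"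
proof (induction rule: loop.induct)
  case (stop s)
  then show ?case by (intro exI[of _ 0]) simp
next
  case (step s i s' t)
  then obtain T where T: "iter \<sigma> T s' = Some t" "\<tau> t = Some 0"
    "\<And>z. z < T \<Longrightarrow> \<exists>i. Option.bind (iter \<sigma> z s') \<tau> = Some (Suc i)" by blast
  have "\<exists>i. Option.bind (iter \<sigma> z s) \<tau> = Some (Suc i)" if "z < Suc T" for z
    using that T(3) step.hyps by (cases z) (auto simp: iter_Suc)
  with T step.hyps show ?case by (intro exI[of _ "Suc T"]) (auto simp: iter_Suc)
qed

text \<open>\<open>Mu\<close> finds the number of rounds after which the test is 0, and the final
  state is then recomputed from that number. The list \<open>ys\<close> holds parameters that stay
  fixed during the loop.\<close>

lemma rec_fun_loop:
  assumes \<tau>: "rec_fun (Suc k) \<tau>" and \<sigma>: "rec_fun (Suc k) \<sigma>"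
  obtains W where "rec_fun (Suc k) W"
    and "\<And>s ys t. length ys = k \<Longrightarrow> loop (\<lambda>s. \<tau> (s # ys)) (\<lambda>s. \<sigma> (s # ys)) s t \<Longrightarrow>
      W (s # ys) = Some t"
proof -
  define I where "I xs = iter (\<lambda>s. \<sigma> (s # drop 2 xs)) (xs ! 0) (xs ! 1)" for xs
  define F where "F xs = Option.bind (I xs) (\<lambda>u. \<tau> (u # drop 2 xs))" for xs
  \<comment> \<open>The arguments are the round counter, the current state, the initial state and
    \<open>ys\<close>, so \<open>\<sigma>\<close> receives entry 1 followed by everything from entry
    3.\<close>
  have "rec_fun (Suc (Suc (Suc k))) (\<lambda>xs. \<sigma> (map ((!) xs) (1 # [3..<3 + k])))"
    using \<sigma> by (intro rec_fun_proj) auto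
  then have "rec_fun (Suc (Suc (Suc k))) (\<lambda>xs. \<sigma> (xs ! 1 # drop 3 xs))"
    by (rule rec_fun_cong) (simp add: map_nth_upt del: upt_Suc)
  from rec_fun_primrec[OF rec_fun_Some[OF total_rec_nth[of 0 "Suc k"]] this]
  have I: "rec_fun (Suc (Suc k)) I"
    by (rule rec_fun_cong) (auto simp: I_def iter_def length_Suc_conv numeral_2_eq_2)
  have "rec_fun (Suc (Suc (Suc k))) (\<lambda>xs. \<tau> (map ((!) xs) (0 # [3..<3 + k])))"
    using \<tau> by (intro rec_fun_proj) auto
  then have "rec_fun (Suc (Suc (Suc k))) (\<lambda>xs. \<tau> (xs ! 0 # drop 3 xs))"
    by (rule rec_fun_cong) (simp add: map_nth_upt del: upt_Suc)
  from rec_fun_let[OF I this] have F: "rec_fun (Suc (Suc k)) F"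
    by (rule rec_fun_cong) (simp add: F_def)
  show thesis
  proof
    show "rec_fun (Suc k) (\<lambda>xs. Option.bind
        (if \<exists>y. F (y # xs) = Some 0 \<and> (\<forall>z<y. F (z # xs) \<noteq> None)
          then Some (LEAST y. F (y # xs) = Some 0) else None) (\<lambda>T. I (T # xs)))"
      by (rule rec_fun_let[OF rec_fun_Mu[OF F] I])
    fix s ys t
    assume "length ys = k" and "loop (\<lambda>s. \<tau> (s # ys)) (\<lambda>s. \<sigma> (s # ys)) s t"
    from loop_imp_iter[OF this(2)] obtain T where T: "I (T # s # ys) = Some t"
      "\<tau> (t # ys) = Some 0" "\<And>z. z < T \<Longrightarrow> \<exists>i. F (z # s # ys) = Some (Suc i)"
      by (auto simp: I_def F_def)
    have F0: "F (T # s # ys) = Some 0" using T by (simp add: F_def)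
    have least: "(LEAST y. F (y # s # ys) = Some 0) = T"
    proof (rule Least_equality)
      fix y assume "F (y # s # ys) = Some 0"
      with T(3)[of y] show "T \<le> y" by (cases "T \<le> y") auto
    qed (rule F0)
    have "\<exists>y. F (y # s # ys) = Some 0 \<and> (\<forall>z<y. F (z # s # ys) \<noteq> None)"
      using F0 T(3) by (intro exI[of _ T]) force
    then show "Option.bind
        (if \<exists>y. F (y # s # ys) = Some 0 \<and> (\<forall>z<y. F (z # s # ys) \<noteq> None)
          then Some (LEAST y. F (y # s # ys) = Some 0) else None) (\<lambda>T. I (T # s # ys)) = Some t"
      by (simp only: if_True least bind.bind_lunit T(1))
  qed
qed

section \<open>Sequential computations\<close>

text \<open>Any tag other than 1 is read as a query, so every partial function on numbers denotes a
  functional. This lets functionals be indexed by programs.\<close>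

definition functional :: "(nat \<rightharpoonup> nat) \<Rightarrow> (nat list \<rightharpoonup> bool \<times> nat)" where
  "functional \<phi> xs =
    map_option (\<lambda>v. (fst (prod_decode v) = 1, snd (prod_decode v))) (\<phi> (list_encode xs))"

text \<open>A tag above 1 would be decoded as a query and encoded again with tag 0; the bound on
  tags makes decoding invertible.\<close>

lemma seq_computable_functional:
  assumes "partial_computable \<phi>" and "\<And>m v. \<phi> m = Some v \<Longrightarrow> fst (prod_decode v) \<le> 1"
  shows "seq_computable (functional \<phi>)"
proof -
  have "v = prod_encode (of_bool (fst (prod_decode v) = 1), snd (prod_decode v))"
    if "\<phi> m = Some v" for m v
  proof -
    have "of_bool (fst (prod_decode v) = 1) = fst (prod_decode v)"
      using assms(2)[OF that] by (cases "fst (prod_decode v)") auto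
    then show ?thesis by simp
  qed
  then have "\<phi> (list_encode xs) =
      map_option (\<lambda>(b, q). prod_encode (of_bool b, q)) (functional \<phi> xs)" for xs
    by (cases "\<phi> (list_encode xs)") (auto simp: functional_def)
  with assms(1) show ?thesis unfolding seq_computable_def by blast
qed

text \<open>Enumerating programs therefore reaches all computable functionals, which leaves only
  countably many requirements.\<close>

lemma seq_computable_imp_functional:
  assumes "seq_computable \<Phi>"
  obtains r where "\<Phi> = functional (\<lambda>n. rec_eval r [n])"
proof -
  obtain r where r: "\<And>xs. rec_eval r [list_encode xs] =
      map_option (\<lambda>(b, q). prod_encode (of_bool b, q)) (\<Phi> xs)"
    using assms unfolding seq_computable_def partial_computable_def by metis
  have "\<Phi> xs = functional (\<lambda>n. rec_eval r [n]) xs" for xs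
    by (cases "\<Phi> xs") (auto simp: functional_def r of_bool_def split: if_splits)
  then show thesis using that by blast
qed

lemma seq_run_mono:
  assumes "g \<subseteq>\<^sub>m g'" and "seq_run \<Phi> g n as y"
  shows "seq_run \<Phi> g' n as y"
  using assms(2)
proof (induction rule: seq_run.induct)
  case (halt as q)
  then show ?case by (rule seq_run.halt)
next
  case (query as q a y)
  have "g' q = Some a" using query.hyps(2) assms(1) by (auto simp: map_le_def dom_def)
  with query show ?case by (blast intro: seq_run.query)
qed

lemma map_le_iff_Some: "f \<subseteq>\<^sub>m g \<longleftrightarrow> (\<forall>n y. f n = Some y \<longrightarrow> g n = Some y)"
  unfolding map_le_def dom_def by fastforce

lemma seq_comp_mono: "g \<subseteq>\<^sub>m g' \<Longrightarrow> seq_comp \<Phi> g \<subseteq>\<^sub>m seq_comp \<Phi> g'"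
  unfolding map_le_iff_Some[of "seq_comp \<Phi> g"] seq_comp_eq_Some_iff
  by (blast intro: seq_run_mono)

section \<open>Blocked runs\<close>

text \<open>Singles out runs that wait for a missing oracle value from those that fail because
  \<open>\<Phi>\<close> is undefined or that query for ever. Only the former can be revived by a
  larger oracle.\<close>

inductive stuck ::
  "(nat list \<rightharpoonup> bool \<times> nat) \<Rightarrow> (nat \<rightharpoonup> nat) \<Rightarrow> nat \<Rightarrow> nat list \<Rightarrow> nat \<Rightarrow> bool"
  for \<Phi> g n where
  here: "\<lbrakk>\<Phi> (n # as) = Some (False, q); g q = None\<rbrakk> \<Longrightarrow> stuck \<Phi> g n as q"
| later: "\<lbrakk>\<Phi> (n # as) = Some (False, q'); g q' = Some a; stuck \<Phi> g n (as @ [a]) q\<rbrakk>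
          \<Longrightarrow> stuck \<Phi> g n as q"

lemma stuck_functional: "stuck \<Phi> g n as q \<Longrightarrow> stuck \<Phi> g n as q' \<Longrightarrow> q = q'"
proof (induction rule: stuck.induct)
  case (here as q)
  from here(3) show ?case by cases (use here in auto)
next
  case (later as q'' a q)
  from later.prems show ?case by cases (use later in auto)
qed

lemma stuck_undefined: "stuck \<Phi> g n as q \<Longrightarrow> g q = None"
  by (induction rule: stuck.induct) auto

text \<open>The smaller oracle gives the same answers as long as it answers at all, so the run is
  either completed or stopped at the first query that only \<open>g'\<close> answers.\<close>

lemma seq_run_restrict_or_stuck:
  assumes "g \<subseteq>\<^sub>m g'" and "seq_run \<Phi> g' n as y"
  shows "seq_run \<Phi> g n as y \<or> (\<exists>q. stuck \<Phi> g n as q \<and> q \<in> dom g')"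
  using assms(2)
proof (induction rule: seq_run.induct)
  case (halt as q)
  then show ?case by (blast intro: seq_run.halt)
next
  case (query as q a y)
  show ?case
  proof (cases "g q")
    case None
    with query.hyps show ?thesis by (blast intro: stuck.here)
  next
    case (Some a')
    with assms(1) query.hyps(2) have "g q = Some a" by (auto simp: map_le_def dom_def)
    with query show ?thesis by (blast intro: seq_run.query stuck.later)
  qed
qed

text \<open>If the outer run blocks at \<open>q\<close>, then \<open>\<Lambda>\<close> has a value
  at \<open>q\<close> with oracle \<open>o2\<close> but none with \<open>o1\<close>, so the inner
  run on \<open>q\<close> blocks in its turn. The failure is thus traced to an argument of the
  innermost oracle.\<close>

lemma seq_comp_seq_comp_restrict_or_stuck:
  assumes "o1 \<subseteq>\<^sub>m o2" and "seq_comp \<Theta> (seq_comp \<Lambda> o2) n = Some y"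
  shows "seq_comp \<Theta> (seq_comp \<Lambda> o1) n = Some y \<or>
    (\<exists>q m. stuck \<Theta> (seq_comp \<Lambda> o1) n [] q \<and> stuck \<Lambda> o1 q [] m \<and> m \<in> dom o2)"
proof -
  have "\<exists>m. stuck \<Lambda> o1 q [] m \<and> m \<in> dom o2"
    if "stuck \<Theta> (seq_comp \<Lambda> o1) n [] q" and "q \<in> dom (seq_comp \<Lambda> o2)" for q
  proof -
    from that(2) obtain z where "seq_run \<Lambda> o2 q [] z"
      by (auto simp: seq_comp_eq_Some_iff)
    moreover have "\<not> seq_run \<Lambda> o1 q [] z"
      using stuck_undefined[OF that(1)] by (simp flip: seq_comp_eq_Some_iff)
    ultimately show ?thesis using seq_run_restrict_or_stuck[OF assms(1)] by blast
  qed
  with seq_run_restrict_or_stuck[OF seq_comp_mono[OF assms(1)]] assms(2) show ?thesis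
    unfolding seq_comp_eq_Some_iff by meson
qed

section \<open>First differing queries\<close>

inductive first_diff :: "(nat list \<rightharpoonup> bool \<times> nat) \<Rightarrow> (nat \<rightharpoonup> nat) \<Rightarrow> (nat \<rightharpoonup> nat) \<Rightarrow> nat \<Rightarrow>
    nat list \<Rightarrow> nat \<Rightarrow> nat \<Rightarrow> nat \<Rightarrow> bool"
  for \<Theta> G0 G1 n where
  here: "\<lbrakk>\<Theta> (n # as) = Some (False, q); G0 q = Some u0; G1 q = Some u1; u0 \<noteq> u1\<rbrakk>
    \<Longrightarrow> first_diff \<Theta> G0 G1 n as q u0 u1"
| later: "\<lbrakk>\<Theta> (n # as) = Some (False, q'); G0 q' = Some u; G1 q' = Some u;
    first_diff \<Theta> G0 G1 n (as @ [u]) q u0 u1\<rbrakk> \<Longrightarrow> first_diff \<Theta> G0 G1 n as q u0 u1"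

lemma first_diff_neq: "first_diff \<Theta> G0 G1 n as q u0 u1 \<Longrightarrow> u0 \<noteq> u1"
  by (induction rule: first_diff.induct) auto

text \<open>Equal answers lead deterministic runs to equal queries and outputs, so different outputs
  force a disagreement on the way.\<close>

lemma first_diff_exists:
  assumes "seq_run \<Theta> G0 n as y0" "seq_run \<Theta> G1 n as y1" "y0 \<noteq> y1"
  shows "\<exists>q u0 u1. first_diff \<Theta> G0 G1 n as q u0 u1"
  using assms
proof (induction rule: seq_run.induct)
  case (halt as q)
  from halt(2) show ?case by cases (use halt in auto)
next
  case (query as q a y)
  from query.prems(1) show ?case
  proof cases
    case halt
    with query.hyps show ?thesis by simp
  next
    case q1: (query q1 a1)
    with query.hyps have [simp]: "q1 = q" by simp
    show ?thesis
    proof (cases "a1 = a")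
      case True
      with q1 query.IH query.prems(2) obtain q2 u0 u1
        where "first_diff \<Theta> G0 G1 n (as @ [a]) q2 u0 u1" by auto
      with True q1 query.hyps have "first_diff \<Theta> G0 G1 n as q2 u0 u1"
        by (auto intro: first_diff.later)
      then show ?thesis by blast
    next
      case False
      with q1 query.hyps show ?thesis by (auto intro: first_diff.here)
    qed
  qed
qed

text \<open>\<open>G\<close> and the oracle selected by \<open>b\<close> are compatible through
  their common extension \<open>H\<close>, although neither need contain the other. The halting run
  with \<open>G\<close> hence repeats the common queries, and at \<open>q\<close> it must receive an
  answer, which compatibility determines.\<close>

lemma first_diff_answer:
  assumes "first_diff \<Theta> G0 G1 n as q u0 u1" and "seq_run \<Theta> G n as y"
    and "G \<subseteq>\<^sub>m H" "(if b then G1 else G0) \<subseteq>\<^sub>m H"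
  shows "G q = Some (if b then u1 else u0)"
proof -
  have eq: "a = c" if "G p = Some a" "(if b then G1 else G0) p = Some c" for p a c
  proof -
    have "H p = Some a" "H p = Some c"
      using assms(3,4) that unfolding map_le_iff_Some by blast+
    then show ?thesis by simp
  qed
  show ?thesis using assms(1,2)
  proof (induction rule: first_diff.induct)
    case (here as q u0 u1)
    from here(5) obtain a where "G q = Some a" by cases (use here in auto)
    with here eq[of q a] show ?case by (auto split: if_splits)
  next
    case (later as q' u q u0 u1)
    from later.prems obtain a where "G q' = Some a" "seq_run \<Theta> G n (as @ [a]) y"
      by cases (use later.hyps in auto)
    moreover from this later.hyps eq[of q' a u] have "a = u" by (auto split: if_splits)
    ultimately show ?case using later.IH by simp
  qed
qed

section \<open>Effective search for the first difference\<close>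

text \<open>The oracle \<open>p(n \<mapsto> b)\<close> is a finite table, so runs can be simulated
  uniformly in \<open>q\<close>, \<open>n\<close> and \<open>b\<close>.\<close>

lemma rec_fun_seq_comp_finite:
  assumes "seq_computable \<Lambda>" and "finite (dom p)"
  obtains E where "rec_fun 3 E"
    and "\<And>q n b y. seq_comp \<Lambda> (p(n \<mapsto> b)) q = Some y \<Longrightarrow> E [q, n, b] = Some y"
proof -
  obtain l where "partial_computable l" and l: "\<And>xs. l (list_encode xs) =
      map_option (\<lambda>(b, q). prod_encode (of_bool b, q)) (\<Lambda> xs)"
    using assms(1) by (auto simp: seq_computable_def)
  then have rl: "rec_fun 1 (\<lambda>xs. l (xs ! 0))"
    by (simp add: partial_computable_iff_rec_fun)
  define L where "L xs = (p(xs ! 1 \<mapsto> xs ! 2)) (xs ! 0)" for xs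
  define w where "w q = (case p q of None \<Rightarrow> 0 | Some v \<Rightarrow> Suc v)" for q
  have w: "total_rec k A \<Longrightarrow> total_rec k (\<lambda>xs. w (A xs))" for k A
    unfolding w_def by (rule total_rec_finite_map[OF assms(2)])
  \<comment> \<open>The first guard tests whether the query is \<open>n\<close>, the second whether
    \<open>w\<close> is positive, that is, whether \<open>p\<close> is defined there.\<close>
  have "rec_fun 3 (\<lambda>xs. if (xs ! 0 - xs ! 1) + (xs ! 1 - xs ! 0) = 0 then Some (xs ! 2)
      else if 1 - w (xs ! 0) = 0 then Some (w (xs ! 0) - 1) else None)"
    by (intro rec_fun_if rec_fun_None total_rec_intros w) auto
  then have rL: "rec_fun 3 L"
    by (rule rec_fun_cong) (auto simp: L_def w_def split: option.split)
  \<comment> \<open>The loop state codes the input followed by the answers so far. The test vanishes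
    at the output tag 1; the body appends the next answer.\<close>
  define \<tau> where "\<tau> xs = Option.bind (l (xs ! 0)) (\<lambda>v. Some (1 - fst (prod_decode v)))" for xs
  define \<sigma> where "\<sigma> xs = Option.bind (l (xs ! 0)) (\<lambda>v.
      Option.bind (L [snd (prod_decode v), xs ! 1, xs ! 2]) (\<lambda>a. Some (code_snoc (xs ! 0) a)))" for xs
  have ls: "rec_fun k (\<lambda>xs. l (xs ! i))" if "i < k" for i k
    using rec_fun_subst1[OF rl total_rec_nth[OF that]] by simp
  have r\<tau>: "rec_fun (Suc 2) \<tau>"
    unfolding \<tau>_def by (intro rec_fun_bind ls rec_fun_Some total_rec_intros) auto
  have "rec_fun (Suc (Suc 3)) (\<lambda>xs. Some (code_snoc (xs ! 2) (xs ! 0)))"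
    by (intro rec_fun_Some total_rec_intros) auto
  moreover have "rec_fun (Suc 3) (\<lambda>xs. L [snd (prod_decode (xs ! 0)), xs ! 2, xs ! 3])"
    by (intro rec_fun_subst3[OF rL] total_rec_intros) auto
  ultimately have "rec_fun (Suc 3) (\<lambda>xs. Option.bind
      (L [snd (prod_decode (xs ! 0)), xs ! 2, xs ! 3]) (\<lambda>a. Some (code_snoc (xs ! 1) a)))"
    using rec_fun_let by fastforce
  from rec_fun_let[OF ls[of 0 3] this] have r\<sigma>: "rec_fun (Suc 2) \<sigma>"
    by (simp add: \<sigma>_def[abs_def] numeral_3_eq_3 numeral_2_eq_2)
  obtain W where rW: "rec_fun (Suc 2) W" and W: "\<And>s ys t. length ys = 2 \<Longrightarrow>
      loop (\<lambda>s. \<tau> (s # ys)) (\<lambda>s. \<sigma> (s # ys)) s t \<Longrightarrow> W (s # ys) = Some t"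
    using rec_fun_loop[OF r\<tau> r\<sigma>] by blast
  \<comment> \<open>\<open>Suc (prod_encode (x, 0))\<close> is the code of \<open>[x]\<close>, the
    state before the first answer.\<close>
  define E where "E xs = Option.bind (Option.bind (W [Suc (prod_encode (xs ! 0, 0)), xs ! 1, xs ! 2]) l)
      (\<lambda>v. Some (snd (prod_decode v)))" for xs
  show thesis
  proof
    show "rec_fun 3 E" unfolding E_def
      by (intro rec_fun_bind rl rec_fun_Some rec_fun_subst3 rW[simplified] total_rec_intros) auto
    fix q n b y
    have run: "\<exists>t. loop (\<lambda>s. \<tau> [s, n, b]) (\<lambda>s. \<sigma> [s, n, b]) (list_encode (q # as)) t \<and>
        l t = Some (prod_encode (1, y))"
      if "seq_run \<Lambda> (p(n \<mapsto> b)) q as y" for as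
      using that
    proof (induction rule: seq_run.induct)
      case (halt as y)
      then have "l (list_encode (q # as)) = Some (prod_encode (1, y))" by (simp only: l) simp
      then show ?case by (intro exI[of _ "list_encode (q # as)"]) (auto intro!: loop.stop simp: \<tau>_def)
    next
      case (query as m a y)
      then have v: "l (list_encode (q # as)) = Some (prod_encode (0, m))" by (simp only: l) simp
      have "\<tau> [list_encode (q # as), n, b] = Some (Suc 0)"
        using v by (simp add: \<tau>_def)
      moreover have "\<sigma> [list_encode (q # as), n, b] = Some (list_encode (q # as @ [a]))"
        using v query.hyps(2) code_simps(5)[of "q # as" a] by (simp add: \<sigma>_def L_def split: if_splits)
      ultimately show ?case using query.IH by (blast intro: loop.step)
    qed
    assume "seq_comp \<Lambda> (p(n \<mapsto> b)) q = Some y"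
    then have "seq_run \<Lambda> (p(n \<mapsto> b)) q [] y" by (simp add: seq_comp_eq_Some_iff)
    from run[OF this] show "E [q, n, b] = Some y"
      by (auto simp: E_def dest!: W[of "[n, b]", simplified])
  qed
qed

text \<open>\<open>\<Theta>\<close> is simulated on \<open>n\<close>, each query being answered for
  both values at \<open>n\<close>, and common answers extend the history until the two differ. Since
  \<open>u1\<close> then differs from \<open>u0\<close>, comparison with \<open>u0\<close> suffices
  to classify the true answer.\<close>

lemma rec_fun_first_diff:
  assumes "seq_computable \<Theta>" "seq_computable \<Lambda>" "finite (dom p)"
  obtains D where "rec_fun 1 D"
    and "\<And>n q u0 u1. first_diff \<Theta> (seq_comp \<Lambda> (p(n \<mapsto> 0))) (seq_comp \<Lambda> (p(n \<mapsto> 1))) n [] q u0 u1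
      \<Longrightarrow> D [n] = Some (prod_encode (q, u0))"
proof -
  obtain E where rE: "rec_fun 3 E"
    and E: "\<And>q n b y. seq_comp \<Lambda> (p(n \<mapsto> b)) q = Some y \<Longrightarrow> E [q, n, b] = Some y"
    using rec_fun_seq_comp_finite[OF assms(2,3)] by blast
  obtain l where "partial_computable l" and l: "\<And>xs. l (list_encode xs) =
      map_option (\<lambda>(b, q). prod_encode (of_bool b, q)) (\<Theta> xs)"
    using assms(1) by (auto simp: seq_computable_def)
  then have "rec_fun 1 (\<lambda>xs. l (xs ! 0))"
    by (simp add: partial_computable_iff_rec_fun)
  from rec_fun_subst1[OF this total_rec_nth[of 0 2]] have rl: "rec_fun 2 (\<lambda>xs. l (xs ! 0))"
    by simp
  \<comment> \<open>The tag of the value of \<open>\<Theta>\<close> is not inspected: on the way to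
    a first difference all values are queries.\<close>
  define Q where "Q b xs = Option.bind (l (xs ! 0)) (\<lambda>v. E [snd (prod_decode v), xs ! 1, b])" for b xs
  have rQ: "rec_fun 2 (Q b)" for b
  proof -
    have "rec_fun (Suc 2) (\<lambda>xs. E [snd (prod_decode (xs ! 0)), xs ! 2, b])"
      by (intro rec_fun_subst3[OF rE] total_rec_intros) auto
    from rec_fun_let[OF rl this] show ?thesis
      by (rule rec_fun_cong) (simp add: Q_def)
  qed
  define \<tau> where "\<tau> xs = Option.bind (Q 0 xs) (\<lambda>u0. Option.bind (Q 1 xs)
      (\<lambda>u1. Some (if u0 = u1 then 1 else 0 :: nat)))" for xs
  define \<sigma> where "\<sigma> xs = Option.bind (Q 0 xs) (\<lambda>u. Some (code_snoc (xs ! 0) u))" for xs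
  have "rec_fun (Suc (Suc 2)) (\<lambda>xs. Some (if xs ! 1 = xs ! 0 then 1 else 0))"
    by (intro rec_fun_Some total_rec_intros) auto
  moreover have "rec_fun (Suc 2) (\<lambda>xs. Q 1 (map ((!) xs) [1, 2]))"
    by (intro rec_fun_proj) (auto simp: rQ[of 1, unfolded numeral_2_eq_2, simplified])
  ultimately have "rec_fun (Suc 2) (\<lambda>xs. Option.bind (Q 1 (map ((!) xs) [1, 2]))
      (\<lambda>u1. Some (if (u1 # xs) ! 1 = (u1 # xs) ! 0 then 1 else 0)))"
    by (intro rec_fun_let)
  from rec_fun_let[OF rQ[of 0] this] have r\<tau>: "rec_fun (Suc 1) \<tau>"
    unfolding Suc_1 by (rule rec_fun_cong) (auto simp: \<tau>_def length_Suc_conv numeral_2_eq_2)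
  have "rec_fun (Suc 2) (\<lambda>xs. Some (code_snoc (xs ! 1) (xs ! 0)))"
    by (intro rec_fun_Some total_rec_intros) auto
  from rec_fun_let[OF rQ[of 0] this] have r\<sigma>: "rec_fun (Suc 1) \<sigma>"
    unfolding Suc_1 by (rule rec_fun_cong) (simp add: \<sigma>_def)
  obtain W where rW: "rec_fun (Suc 1) W" and W: "\<And>s ys t. length ys = 1 \<Longrightarrow>
      loop (\<lambda>s. \<tau> (s # ys)) (\<lambda>s. \<sigma> (s # ys)) s t \<Longrightarrow> W (s # ys) = Some t"
    using rec_fun_loop[OF r\<tau> r\<sigma>] by blast
  \<comment> \<open>The loop returns only a history; the query pending there and its answer for the
    value 0 are recomputed from it.\<close>
  define R where "R xs = Option.bind (l (xs ! 0)) (\<lambda>v. Option.bind (E [snd (prod_decode v), xs ! 1, 0])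
      (\<lambda>u. Some (prod_encode (snd (prod_decode v), u))))" for xs
  have rR: "rec_fun 2 R"
  proof -
    have "rec_fun (Suc (Suc 2)) (\<lambda>xs. Some (prod_encode (snd (prod_decode (xs ! 1)), xs ! 0)))"
      by (intro rec_fun_Some total_rec_intros) auto
    moreover have "rec_fun (Suc 2) (\<lambda>xs. E [snd (prod_decode (xs ! 0)), xs ! 2, 0])"
      by (intro rec_fun_subst3[OF rE] total_rec_intros) auto
    ultimately have "rec_fun (Suc 2) (\<lambda>xs. Option.bind (E [snd (prod_decode (xs ! 0)), xs ! 2, 0])
        (\<lambda>u. Some (prod_encode (snd (prod_decode ((u # xs) ! 1)), (u # xs) ! 0))))"
      by (intro rec_fun_let)
    from rec_fun_let[OF rl this] show ?thesis
      by (rule rec_fun_cong) (simp add: R_def)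
  qed
  have rW': "rec_fun 1 (\<lambda>xs. W [Suc (prod_encode (xs ! 0, 0)), xs ! 0])"
    by (intro rec_fun_subst2[OF rW[unfolded Suc_1]] total_rec_intros) auto
  have rR': "rec_fun (Suc 1) (\<lambda>xs. R [xs ! 0, xs ! 1])"
    by (intro rec_fun_subst2[OF rR] total_rec_intros) auto
  show thesis
  proof
    show "rec_fun 1 (\<lambda>xs. Option.bind (W [Suc (prod_encode (xs ! 0, 0)), xs ! 0])
        (\<lambda>t. R [(t # xs) ! 0, (t # xs) ! 1]))"
      by (rule rec_fun_let[OF rW' rR'])
    fix n q u0 u1
    let ?G = "\<lambda>b. seq_comp \<Lambda> (p(n \<mapsto> b))"
    have Q: "Q b [list_encode (n # as), n] = Some u"
      if "\<Theta> (n # as) = Some (False, m)" "?G b m = Some u" for as b m u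
      using that l[of "n # as"] E by (simp add: Q_def)
    have "\<exists>t. loop (\<lambda>s. \<tau> [s, n]) (\<lambda>s. \<sigma> [s, n]) (list_encode (n # as)) t \<and>
        R [t, n] = Some (prod_encode (q, u0))"
      if "first_diff \<Theta> (?G 0) (?G 1) n as q u0 u1" for as
      using that
    proof (induction rule: first_diff.induct)
      case (here as q u0 u1)
      have "\<tau> [list_encode (n # as), n] = Some 0"
        using Q[OF here(1,2)] Q[OF here(1,3)] here(4) by (simp add: \<tau>_def)
      moreover have "R [list_encode (n # as), n] = Some (prod_encode (q, u0))"
        using l[of "n # as"] E[OF here(2)] here(1) by (simp add: R_def)
      ultimately show ?case by (blast intro: loop.stop)
    next
      case (later as q' u q u0 u1)
      have "\<tau> [list_encode (n # as), n] = Some (Suc 0)"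
        using Q[OF later(1,2)] Q[OF later(1,3)] by (simp add: \<tau>_def)
      moreover have "\<sigma> [list_encode (n # as), n] = Some (list_encode (n # as @ [u]))"
        using Q[OF later(1,2)] code_simps(5)[of "n # as" u] by (simp add: \<sigma>_def)
      ultimately show ?case using later.IH by (blast intro: loop.step)
    qed
    moreover assume "first_diff \<Theta> (?G 0) (?G 1) n [] q u0 u1"
    ultimately show "Option.bind (W [Suc (prod_encode ([n] ! 0, 0)), [n] ! 0])
        (\<lambda>t. R [(t # [n]) ! 0, (t # [n]) ! 1]) = Some (prod_encode (q, u0))"
      by (force dest!: W[of "[n]", simplified])
  qed
qed

text \<open>Values on \<open>dom p\<close> are stored. For other \<open>n\<close> the differing
  query \<open>q\<close> is computed, \<open>g\<close> is asked at the component index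
  \<open>q div 2\<close>, and the answer tells 0 from 1. Here \<open>g\<close> stands for either
  component of a join. Membership in a reservoir is never tested, so reservoirs may be
  noncomputable.\<close>

lemma subT_le_of_first_diff:
  assumes "seq_computable \<Theta>" "seq_computable \<Lambda>" "finite (dom p)" and "p \<subseteq>\<^sub>m f"
    and diff: "\<And>n b. f n = Some b \<Longrightarrow> n \<notin> dom p \<Longrightarrow> \<exists>q u0 u1. b \<le> 1 \<and>
      first_diff \<Theta> (seq_comp \<Lambda> (p(n \<mapsto> 0))) (seq_comp \<Lambda> (p(n \<mapsto> 1))) n [] q u0 u1 \<and>
      g (q div 2) = Some (if b = 0 then u0 else u1)"
  shows "f \<le>\<^sub>s\<^sub>u\<^sub>b\<^sub>T g"
proof -
  obtain D where rD: "rec_fun 1 D" and D: "\<And>n q u0 u1.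
      first_diff \<Theta> (seq_comp \<Lambda> (p(n \<mapsto> 0))) (seq_comp \<Lambda> (p(n \<mapsto> 1))) n [] q u0 u1
      \<Longrightarrow> D [n] = Some (prod_encode (q, u0))"
    using rec_fun_first_diff[OF assms(1-3)] by blast
  define w where "w q = (case p q of None \<Rightarrow> 0 | Some v \<Rightarrow> Suc v)" for q
  have w: "total_rec k A \<Longrightarrow> total_rec k (\<lambda>xs. w (A xs))" for k A
    unfolding w_def by (rule total_rec_finite_map[OF assms(3)])
  \<comment> \<open>\<open>m\<close> codes the input followed by the answers:
    \<open>code_tl m = 0\<close> means that no answer has arrived, and
    \<open>code_hd (code_tl m)\<close> is the first answer.\<close>
  define \<gamma> where "\<gamma> m = (if 1 - w (code_hd m) = 0 then Some (prod_encode (1, w (code_hd m) - 1))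
      else Option.bind (D [code_hd m]) (\<lambda>d. Some (if code_tl m = 0
        then prod_encode (0, fst (prod_decode d) div 2)
        else prod_encode (1, if code_hd (code_tl m) = snd (prod_decode d) then 0 else 1))))" for m
  have "rec_fun (Suc 1) (\<lambda>xs. Some (if code_tl (xs ! 1) = 0
        then prod_encode (0, fst (prod_decode (xs ! 0)) div 2)
        else prod_encode (1, if code_hd (code_tl (xs ! 1)) = snd (prod_decode (xs ! 0)) then 0 else 1)))"
    by (intro rec_fun_Some total_rec_intros) auto
  moreover have "rec_fun 1 (\<lambda>xs. D [code_hd (xs ! 0)])"
    by (intro rec_fun_subst1[OF rD] total_rec_intros) auto
  ultimately have "rec_fun 1 (\<lambda>xs. Option.bind (D [code_hd (xs ! 0)])
      (\<lambda>d. Some (if code_tl ((d # xs) ! 1) = 0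
        then prod_encode (0, fst (prod_decode ((d # xs) ! 0)) div 2)
        else prod_encode (1, if code_hd (code_tl ((d # xs) ! 1)) = snd (prod_decode ((d # xs) ! 0))
          then 0 else 1))))"
    by (rule rec_fun_let[rotated])
  then have "rec_fun 1 (\<lambda>xs. if 1 - w (code_hd (xs ! 0)) = 0
      then Some (prod_encode (1, w (code_hd (xs ! 0)) - 1))
      else Option.bind (D [code_hd (xs ! 0)])
      (\<lambda>d. Some (if code_tl ((d # xs) ! 1) = 0
        then prod_encode (0, fst (prod_decode ((d # xs) ! 0)) div 2)
        else prod_encode (1, if code_hd (code_tl ((d # xs) ! 1)) = snd (prod_decode ((d # xs) ! 0))
          then 0 else 1))))"
    by (intro rec_fun_if total_rec_intros w) auto
  then have "partial_computable \<gamma>"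
    unfolding partial_computable_iff_rec_fun \<gamma>_def nth_Cons_0 One_nat_def nth_Cons_Suc .
  then have sc: "seq_computable (functional \<gamma>)"
    by (rule seq_computable_functional) (auto simp: \<gamma>_def bind_eq_Some_conv split: if_splits)
  have "seq_run (functional \<gamma>) g n [] b" if fn: "f n = Some b" for n b
  proof (cases "p n")
    case (Some v)
    with fn \<open>p \<subseteq>\<^sub>m f\<close> have "v = b" by (auto simp: map_le_iff_Some)
    with Some show ?thesis
      by (intro seq_run.halt) (simp add: functional_def \<gamma>_def w_def)
  next
    case None
    with diff[OF fn] obtain q u0 u1 where b: "b \<le> 1"
      and fd: "first_diff \<Theta> (seq_comp \<Lambda> (p(n \<mapsto> 0))) (seq_comp \<Lambda> (p(n \<mapsto> 1))) n [] q u0 u1"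
      and g: "g (q div 2) = Some (if b = 0 then u0 else u1)"
      by blast
    have "functional \<gamma> [n] = Some (False, q div 2)"
      using D[OF fd] None by (simp add: functional_def \<gamma>_def w_def)
    moreover have "functional \<gamma> [n, if b = 0 then u0 else u1] = Some (True, b)"
      using D[OF fd] None b first_diff_neq[OF fd]
      by (cases b) (auto simp: functional_def \<gamma>_def w_def)
    ultimately show ?thesis
      using g by (intro seq_run.query[of _ n "[]"] seq_run.halt) auto
  qed
  then have "f \<subseteq>\<^sub>m seq_comp (functional \<gamma>) g"
    by (simp add: map_le_iff_Some seq_comp_eq_Some_iff)
  with sc show ?thesis unfolding subT_le_def by blast
qed

section \<open>Reductions of the components of a join\<close>

lemma subT_le_reindex:
  assumes "f \<le>\<^sub>s\<^sub>u\<^sub>b\<^sub>T g" and e: "\<And>k A. total_rec k A \<Longrightarrow> total_rec k (\<lambda>xs. e (A xs))"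
  shows "(\<lambda>n. f (e n)) \<le>\<^sub>s\<^sub>u\<^sub>b\<^sub>T g"
proof -
  obtain \<Phi> \<phi> where f: "f \<subseteq>\<^sub>m seq_comp \<Phi> g" and "partial_computable \<phi>"
    and \<phi>: "\<And>xs. \<phi> (list_encode xs) = map_option (\<lambda>(b, q). prod_encode (of_bool b, q)) (\<Phi> xs)"
    using assms(1) by (auto simp: subT_le_def seq_computable_def)
  \<comment> \<open>The value at \<open>[]\<close> matches the coded version, in which the code 0
    has head 0 and tail 0.\<close>
  define \<Phi>' where "\<Phi>' xs = (case xs of [] \<Rightarrow> \<Phi> [e 0] | x # xs \<Rightarrow> \<Phi> (e x # xs))" for xs
  have "rec_fun 1 (\<lambda>xs. \<phi> ([Suc (prod_encode (e (code_hd (xs ! 0)), code_tl (xs ! 0)))] ! 0))"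
    using \<open>partial_computable \<phi>\<close> unfolding partial_computable_iff_rec_fun
    by (rule rec_fun_subst1) (intro e total_rec_intros; simp)
  then have "partial_computable (\<lambda>m. \<phi> (Suc (prod_encode (e (code_hd m), code_tl m))))"
    by (simp add: partial_computable_iff_rec_fun)
  moreover have "\<phi> (Suc (prod_encode (e (code_hd (list_encode xs)), code_tl (list_encode xs)))) =
      map_option (\<lambda>(b, q). prod_encode (of_bool b, q)) (\<Phi>' xs)" for xs
    using \<phi>[of "[e 0]"] \<phi>[of "e (hd xs) # tl xs"] by (cases xs) (auto simp: \<Phi>'_def)
  ultimately have "seq_computable \<Phi>'" unfolding seq_computable_def by blast
  moreover have "seq_run \<Phi> g m as y \<Longrightarrow> m = e n \<Longrightarrow> seq_run \<Phi>' g n as y" for m as y n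
    by (induction rule: seq_run.induct)
      (auto simp: \<Phi>'_def intro: seq_run.halt seq_run.query)
  then have "(\<lambda>n. f (e n)) \<subseteq>\<^sub>m seq_comp \<Phi>' g"
    using f by (simp add: map_le_iff_Some seq_comp_eq_Some_iff)
  ultimately show ?thesis unfolding subT_le_def by blast
qed

lemma subT_le_of_join_le:
  assumes "g \<oplus> h \<le>\<^sub>s\<^sub>u\<^sub>b\<^sub>T f"
  shows "g \<le>\<^sub>s\<^sub>u\<^sub>b\<^sub>T f" and "h \<le>\<^sub>s\<^sub>u\<^sub>b\<^sub>T f"
proof -
  have "(\<lambda>n. (g \<oplus> h) (n + n)) \<le>\<^sub>s\<^sub>u\<^sub>b\<^sub>T f"
    by (rule subT_le_reindex[OF assms]) (intro total_rec_intros)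
  moreover have "(\<lambda>n. (g \<oplus> h) (Suc (n + n))) \<le>\<^sub>s\<^sub>u\<^sub>b\<^sub>T f"
    by (rule subT_le_reindex[OF assms]) (intro total_rec_intros)
  ultimately show "g \<le>\<^sub>s\<^sub>u\<^sub>b\<^sub>T f" "h \<le>\<^sub>s\<^sub>u\<^sub>b\<^sub>T f"
    by (simp_all add: join_def flip: mult_2)
qed

section \<open>The forcing construction\<close>

instance recf :: countable
  by countable_datatype

text \<open>Mathias-style conditions with a finite 0-1-valued partial function as stem. Disjointness
  keeps each point of \<open>X\<close> free to receive either value.\<close>

fun condition :: "(nat \<rightharpoonup> nat) \<times> nat set \<Rightarrow> bool" where
  "condition (p, X) \<longleftrightarrow> finite (dom p) \<and> ran p \<subseteq> {0, 1} \<and> infinite X \<and> dom p \<inter> X = {}"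

fun refines :: "(nat \<rightharpoonup> nat) \<times> nat set \<Rightarrow> (nat \<rightharpoonup> nat) \<times> nat set \<Rightarrow> bool" where
  "refines (p', X') (p, X) \<longleftrightarrow> p \<subseteq>\<^sub>m p' \<and> dom p' \<subseteq> dom p \<union> X \<and> X' \<subseteq> X"

fun meets :: "(nat \<rightharpoonup> nat) \<Rightarrow> (nat \<rightharpoonup> nat) \<times> nat set \<Rightarrow> bool" where
  "meets f (p, X) \<longleftrightarrow> p \<subseteq>\<^sub>m f \<and> dom f \<subseteq> dom p \<union> X \<and> ran f \<subseteq> {0, 1}"

text \<open>Forcing is semantic here: the refinement must secure \<open>R\<close> for every
  \<open>f\<close> that meets it, however the construction goes on.\<close>

definition dense :: "((nat \<rightharpoonup> nat) \<Rightarrow> bool) \<Rightarrow> bool" where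
  "dense R \<longleftrightarrow> (\<forall>c. condition c \<longrightarrow>
    (\<exists>c'. condition c' \<and> refines c' c \<and> (\<forall>f. meets f c' \<longrightarrow> R f)))"

lemma refines_refl: "refines c c"
  by (cases c) simp

lemma refines_trans: "refines c'' c' \<Longrightarrow> refines c' c \<Longrightarrow> refines c'' c"
  by (cases c; cases c'; cases c'') (simp, blast intro: map_le_trans)

text \<open>A Rasiowa-Sikorski argument: a descending sequence of conditions settles the requirement
  \<open>from_nat k\<close> at step \<open>k\<close>, and the union of the stems meets every
  condition.\<close>

lemma generic_exists:
  fixes R :: "'i :: countable \<Rightarrow> (nat \<rightharpoonup> nat) \<Rightarrow> bool"
  assumes "\<And>i. dense (R i)"
  shows "\<exists>f. \<forall>i. R i f"
proof -
  have "\<exists>c. \<forall>k. condition (c k) \<and> refines (c (Suc k)) (c k) \<and>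
      (\<forall>f. meets f (c (Suc k)) \<longrightarrow> R (from_nat k) f)"
  proof (rule dependent_nat_choice)
    show "\<exists>c. condition c" by (rule exI[of _ "(Map.empty, UNIV)"]) simp
    show "\<exists>c'. condition c' \<and> refines c' c \<and> (\<forall>f. meets f c' \<longrightarrow> R (from_nat k) f)"
      if "condition c" for c k
      using assms[of "from_nat k"] that unfolding dense_def by blast
  qed
  then obtain c where c: "\<And>k. condition (c k)"
    "\<And>k. refines (c (Suc k)) (c k)" "\<And>k f. meets f (c (Suc k)) \<Longrightarrow> R (from_nat k) f"
    by blast
  have mono: "refines (c l) (c k)" if "k \<le> l" for k l
    using that by (induction rule: dec_induct) (auto intro: refines_refl refines_trans c(2))
  have sub: "fst (c k) \<subseteq>\<^sub>m fst (c l)" if "k \<le> l" for k l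
    using mono[OF that] by (cases "c k"; cases "c l") simp
  have uniq: "a = b" if "fst (c k) n = Some a" "fst (c l) n = Some b" for a b k l n
  proof -
    have "fst (c (max k l)) n = Some a" "fst (c (max k l)) n = Some b"
      using sub[of k "max k l"] sub[of l "max k l"] that
      unfolding map_le_iff_Some by (meson max.cobounded1 max.cobounded2)+
    then show ?thesis by simp
  qed
  have "\<exists>z. \<forall>v. z = Some v \<longleftrightarrow> (\<exists>k. fst (c k) n = Some v)" for n
  proof (cases "\<exists>k v. fst (c k) n = Some v")
    case True
    then obtain k v where "fst (c k) n = Some v" by blast
    then show ?thesis by (intro exI[of _ "Some v"]) (auto dest: uniq)
  next
    case False
    then show ?thesis by (intro exI[of _ None]) auto
  qed
  then obtain f where f: "\<And>n v. f n = Some v \<longleftrightarrow> (\<exists>k. fst (c k) n = Some v)"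
    by metis
  have "meets f (c k)" for k
  proof -
    obtain p X where pX: "c k = (p, X)" by force
    have "p \<subseteq>\<^sub>m f" using pX f by (auto simp: map_le_iff_Some intro: exI[of _ k])
    \<comment> \<open>The value at \<open>n\<close> persists to a stage beyond \<open>k\<close>,
      whose condition refines \<open>c k\<close> and so has its domain inside
      \<open>dom p \<union> X\<close>.\<close>
    moreover have "n \<in> dom p \<union> X" if "f n = Some v" for n v
    proof -
      from that f obtain l where l: "fst (c l) n = Some v" by blast
      with sub[of l "max k l"] have "fst (c (max k l)) n = Some v" by (simp add: map_le_iff_Some)
      with mono[of k "max k l"] pX show ?thesis by (cases "c (max k l)") auto
    qed
    moreover have "v \<in> {0, 1}" if "f n = Some v" for n v
    proof -
      from that f obtain l where "fst (c l) n = Some v" by blast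
      with c(1)[of l] show ?thesis by (cases "c l") (auto simp: ran_def)
    qed
    ultimately show ?thesis using pX by (auto simp: ran_def)
  qed
  with c(3) have "R (from_nat k) f" for k by blast
  from this[of "to_nat i" for i :: 'i] show ?thesis unfolding from_nat_to_nat by blast
qed

lemma condition_update:
  assumes "condition (p, X)" "n \<in> X" "b \<in> {0, 1}" "finite Y"
  shows "condition (p(n \<mapsto> b), X - insert n Y)" and "refines (p(n \<mapsto> b), X - insert n Y) (p, X)"
proof -
  have "ran (p(n \<mapsto> b)) \<subseteq> {0, 1}" using assms(1,3) by (auto simp: ran_def)
  moreover have "p n = None" using assms(1,2) by auto
  then have "p \<subseteq>\<^sub>m p(n \<mapsto> b)" by (auto simp: map_le_iff_Some)
  ultimately show "condition (p(n \<mapsto> b), X - insert n Y)"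
    "refines (p(n \<mapsto> b), X - insert n Y) (p, X)"
    using assms by auto
qed

text \<open>\<open>\<phi> n\<close> equals at most one of 0 and 1; the other value, put at a
  reservoir point, diagonalises against an arbitrary partial function.\<close>

lemma dense_not_map_le: "dense (\<lambda>f. \<not> f \<subseteq>\<^sub>m \<phi>)"
  unfolding dense_def
proof (intro allI impI)
  fix c assume "condition c"
  moreover obtain p X where [simp]: "c = (p, X)" by force
  ultimately have c: "condition (p, X)" by simp
  then obtain n where n: "n \<in> X" by (metis all_not_in_conv condition.simps finite.emptyI)
  obtain b :: nat where b: "b \<in> {0, 1}" "\<phi> n \<noteq> Some b"
    by (cases "\<phi> n = Some 0") auto
  have "\<not> f \<subseteq>\<^sub>m \<phi>" if "meets f (p(n \<mapsto> b), X - {n})" for f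
  proof -
    have "f n = Some b" using that by (simp add: map_le_iff_Some)
    with b(2) show ?thesis by (auto simp: map_le_iff_Some)
  qed
  with condition_update[OF c n b(1), of "{}"]
  show "\<exists>c'. condition c' \<and> refines c' c \<and> (\<forall>f. meets f c' \<longrightarrow> \<not> f \<subseteq>\<^sub>m \<phi>)"
    by (intro exI[of _ "(p(n \<mapsto> b), X - {n})"]) auto
qed

lemma dense_join_irreducible:
  assumes "seq_computable \<Theta>" "seq_computable \<Lambda>"
  shows "dense (\<lambda>f. \<forall>g h. f \<subseteq>\<^sub>m seq_comp \<Theta> (g \<oplus> h) \<longrightarrow> g \<oplus> h \<subseteq>\<^sub>m seq_comp \<Lambda> f \<longrightarrow>
    f \<le>\<^sub>s\<^sub>u\<^sub>b\<^sub>T g \<or> f \<le>\<^sub>s\<^sub>u\<^sub>b\<^sub>T h)" (is "dense ?R")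
  unfolding dense_def
proof (intro allI impI)
  fix c assume "condition c"
  moreover obtain p X where cpX: "c = (p, X)" by force
  ultimately have c: "condition (p, X)" by simp
  let ?G = "\<lambda>n b. seq_comp \<Lambda> (p(n \<mapsto> b))"
  show "\<exists>c'. condition c' \<and> refines c' c \<and> (\<forall>f. meets f c' \<longrightarrow> ?R f)"
  proof (cases "\<exists>n\<in>X. \<exists>b\<in>{0, 1}. seq_comp \<Theta> (?G n b) n \<noteq> Some b")
    case True
    then obtain n b where n: "n \<in> X" and b: "b \<in> {0, 1}" and ne: "seq_comp \<Theta> (?G n b) n \<noteq> Some b"
      by blast
    \<comment> \<open>By \<open>stuck_functional\<close> at most one oracle argument can block the
      composite run, so deleting \<open>Y\<close> keeps the reservoir infinite.\<close>
    define Y where "Y = {m. \<exists>q. stuck \<Theta> (?G n b) n [] q \<and> stuck \<Lambda> (p(n \<mapsto> b)) q [] m}"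
    have "m = m'" if "m \<in> Y" "m' \<in> Y" for m m'
      using that unfolding Y_def by (blast dest: stuck_functional)
    then have "Y \<subseteq> {m}" if "m \<in> Y" for m using that by blast
    then have Y: "finite Y" by (metis all_not_in_conv finite.simps finite_subset)
    have "?R f" if f: "meets f (p(n \<mapsto> b), X - insert n Y)" for f
    proof (intro allI impI)
      fix g h assume "f \<subseteq>\<^sub>m seq_comp \<Theta> (g \<oplus> h)" "g \<oplus> h \<subseteq>\<^sub>m seq_comp \<Lambda> f"
      \<comment> \<open>The premises are refuted: they make the composite with oracle
        \<open>f\<close> output \<open>b\<close>. With \<open>p(n \<mapsto> b)\<close> it does not,
        so that run blocks at some \<open>m\<close> in \<open>dom f\<close>; but \<open>m\<close>
        lies outside the stem and was deleted from the reservoir.\<close>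
      then have "f \<subseteq>\<^sub>m seq_comp \<Theta> (seq_comp \<Lambda> f)"
        by (blast intro: map_le_trans seq_comp_mono)
      moreover have le: "p(n \<mapsto> b) \<subseteq>\<^sub>m f" using f by simp
      then have "f n = Some b" by (simp add: map_le_iff_Some)
      ultimately have "seq_comp \<Theta> (seq_comp \<Lambda> f) n = Some b" by (simp add: map_le_iff_Some)
      from seq_comp_seq_comp_restrict_or_stuck[OF le this] ne
      obtain q m where qm: "stuck \<Theta> (?G n b) n [] q" "stuck \<Lambda> (p(n \<mapsto> b)) q [] m" "m \<in> dom f"
        by blast
      then have "m \<in> Y" by (auto simp: Y_def)
      moreover have "m \<notin> dom (p(n \<mapsto> b))" using stuck_undefined[OF qm(2)] by (simp only: domIff) simp
      moreover have "dom f \<subseteq> dom (p(n \<mapsto> b)) \<union> (X - insert n Y)" using f by (simp only: meets.simps)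
      ultimately show "f \<le>\<^sub>s\<^sub>u\<^sub>b\<^sub>T g \<or> f \<le>\<^sub>s\<^sub>u\<^sub>b\<^sub>T h" using qm(3) by blast
    qed
    with condition_update[OF c n b Y] show ?thesis
      unfolding cpX by (intro exI[of _ "(p(n \<mapsto> b), X - insert n Y)"] conjI allI impI; blast)
  next
    case False
    then have correct: "seq_run \<Theta> (?G n b) n [] b" if "n \<in> X" "b \<in> {0, 1}" for n b
      using that unfolding seq_comp_eq_Some_iff[symmetric] by blast
    \<comment> \<open>The parity of the differing query tells which component it addresses: even for
      \<open>g\<close>, odd for \<open>h\<close>.\<close>
    define Z where "Z e = {n \<in> X. \<exists>q u0 u1. even q = e \<and> first_diff \<Theta> (?G n 0) (?G n 1) n [] q u0 u1}"
      for e
    have "n \<in> Z True \<union> Z False" if n: "n \<in> X" for n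
    proof -
      obtain q u0 u1 where "first_diff \<Theta> (?G n 0) (?G n 1) n [] q u0 u1"
        using first_diff_exists[OF correct[OF n, of 0] correct[OF n, of 1]] by auto
      with n show ?thesis by (cases "even q") (auto simp: Z_def)
    qed
    then have "X = Z True \<union> Z False" by (auto simp: Z_def)
    then obtain e where "infinite (Z e)"
      using c by (metis condition.simps finite_UnI)
    then have c': "condition (p, Z e)" "refines (p, Z e) c"
      using c by (auto simp: Z_def cpX)
    have "?R f" if f: "meets f (p, Z e)" for f
    proof (intro allI impI)
      fix g h assume \<Theta>: "f \<subseteq>\<^sub>m seq_comp \<Theta> (g \<oplus> h)" and \<Lambda>: "g \<oplus> h \<subseteq>\<^sub>m seq_comp \<Lambda> f"
      have le: "p \<subseteq>\<^sub>m f" using f by simp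
      have "\<exists>q u0 u1. b \<le> 1 \<and> first_diff \<Theta> (?G n 0) (?G n 1) n [] q u0 u1 \<and>
          (if e then g else h) (q div 2) = Some (if b = 0 then u0 else u1)"
        if fn: "f n = Some b" and "n \<notin> dom p" for n b
      proof -
        from that f have "n \<in> Z e" by auto
        then obtain q u0 u1 where q: "even q = e"
          and fd: "first_diff \<Theta> (?G n 0) (?G n 1) n [] q u0 u1"
          by (auto simp: Z_def)
        have b: "b = 0 \<or> b = 1" using fn f by (auto simp: ran_def)
        have "seq_run \<Theta> (g \<oplus> h) n [] b"
          using fn \<Theta> by (simp add: map_le_iff_Some seq_comp_eq_Some_iff)
        moreover have "p(n \<mapsto> b) \<subseteq>\<^sub>m f" using le fn by (simp add: map_le_iff_Some)
        then have "?G n b \<subseteq>\<^sub>m seq_comp \<Lambda> f" by (rule seq_comp_mono)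
        \<comment> \<open>This prepares \<open>first_diff_answer\<close> with
          \<open>seq_comp \<Lambda> f\<close> as common extension of \<open>g \<oplus> h\<close> and
          \<open>?G n b\<close>, the selector being \<open>b = 1\<close>.\<close>
        with b have "(if b = 1 then ?G n 1 else ?G n 0) \<subseteq>\<^sub>m seq_comp \<Lambda> f" by auto
        ultimately have "(g \<oplus> h) q = Some (if b = 1 then u1 else u0)"
          using first_diff_answer[OF fd _ \<Lambda>] by blast
        with b q have "(if e then g else h) (q div 2) = Some (if b = 0 then u0 else u1)"
          by (auto simp: join_def split: if_splits)
        moreover have "b \<le> 1" using b by auto
        ultimately show ?thesis using fd by blast
      qed
      moreover have "finite (dom p)" using c by simp
      ultimately have "f \<le>\<^sub>s\<^sub>u\<^sub>b\<^sub>T (if e then g else h)"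
        using subT_le_of_first_diff[OF assms _ le] by blast
      then show "f \<le>\<^sub>s\<^sub>u\<^sub>b\<^sub>T g \<or> f \<le>\<^sub>s\<^sub>u\<^sub>b\<^sub>T h" by (auto split: if_splits)
    qed
    with c' show ?thesis by (intro exI[of _ "(p, Z e)"] conjI allI impI; blast)
  qed
qed

theorem theorem4p12:
  shows "\<exists>f :: nat \<rightharpoonup> nat.
    \<not> (\<exists>\<phi>. partial_computable \<phi> \<and> f \<subseteq>\<^sub>m \<phi>) \<and>
    (\<forall>g h :: nat \<rightharpoonup> nat. f \<equiv>\<^sub>s\<^sub>u\<^sub>b\<^sub>T g \<oplus> h \<longrightarrow> f \<equiv>\<^sub>s\<^sub>u\<^sub>b\<^sub>T g \<or> f \<equiv>\<^sub>s\<^sub>u\<^sub>b\<^sub>T h)"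
proof -
  define R1 where "R1 r f \<longleftrightarrow> \<not> f \<subseteq>\<^sub>m (\<lambda>n. rec_eval r [n])" for r f
  define F where "F r = functional (\<lambda>n. rec_eval r [n])" for r
  \<comment> \<open>The guards admit every pair of programs as an index; a pair violating them
    satisfies the requirement vacuously.\<close>
  define R2 where "R2 r s f \<longleftrightarrow> (seq_computable (F r) \<longrightarrow> seq_computable (F s) \<longrightarrow>
    (\<forall>g h. f \<subseteq>\<^sub>m seq_comp (F r) (g \<oplus> h) \<longrightarrow> g \<oplus> h \<subseteq>\<^sub>m seq_comp (F s) f \<longrightarrow>
      f \<le>\<^sub>s\<^sub>u\<^sub>b\<^sub>T g \<or> f \<le>\<^sub>s\<^sub>u\<^sub>b\<^sub>T h))" for r s f
  have "dense (R1 r)" for r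
    using dense_not_map_le by (simp add: R1_def[abs_def])
  moreover have "dense (R2 r s)" for r s
  proof (cases "seq_computable (F r) \<and> seq_computable (F s)")
    case True
    then show ?thesis using dense_join_irreducible[of "F r" "F s"] by (simp add: R2_def[abs_def])
  next
    case False
    then have "R2 r s f" for f unfolding R2_def by blast
    then show ?thesis unfolding dense_def using refines_refl by blast
  qed
  \<comment> \<open>The sum type merges both families of requirements into one countable index
    type.\<close>
  ultimately have "dense (case i of Inl r \<Rightarrow> R1 r | Inr (r, s) \<Rightarrow> R2 r s)"
    for i :: "recf + recf \<times> recf"
    by (cases i) (auto split: prod.split)
  from generic_exists[of "\<lambda>i :: recf + recf \<times> recf. case i of Inl r \<Rightarrow> R1 r | Inr (r, s) \<Rightarrow> R2 r s",
    OF this] obtain f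
    where f: "\<And>i. (case i of Inl r \<Rightarrow> R1 r | Inr (r, s) \<Rightarrow> R2 r s) f" by blast
  have R1: "R1 r f" for r using f[of "Inl r"] by simp
  have R2: "R2 r s f" for r s using f[of "Inr (r, s)"] by simp
  have "\<not> f \<subseteq>\<^sub>m \<phi>" if "partial_computable \<phi>" for \<phi>
  proof -
    from that obtain r where "\<phi> = (\<lambda>n. rec_eval r [n])"
      unfolding partial_computable_def by blast
    with R1[of r] show ?thesis by (simp add: R1_def)
  qed
  moreover have "f \<equiv>\<^sub>s\<^sub>u\<^sub>b\<^sub>T g \<or> f \<equiv>\<^sub>s\<^sub>u\<^sub>b\<^sub>T h" if equiv: "f \<equiv>\<^sub>s\<^sub>u\<^sub>b\<^sub>T g \<oplus> h" for g h
  proof -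
    from equiv obtain \<Theta> \<Lambda> where sc: "seq_computable \<Theta>" "seq_computable \<Lambda>"
      and le: "f \<subseteq>\<^sub>m seq_comp \<Theta> (g \<oplus> h)" "g \<oplus> h \<subseteq>\<^sub>m seq_comp \<Lambda> f"
      unfolding subT_equiv_def subT_le_def by blast
    obtain r where "\<Theta> = F r"
      unfolding F_def by (rule seq_computable_imp_functional[OF sc(1)])
    moreover obtain s where "\<Lambda> = F s"
      unfolding F_def by (rule seq_computable_imp_functional[OF sc(2)])
    ultimately have "f \<le>\<^sub>s\<^sub>u\<^sub>b\<^sub>T g \<or> f \<le>\<^sub>s\<^sub>u\<^sub>b\<^sub>T h" 
      using sc le R2[of r s] unfolding R2_def by blast
    \<comment> \<open>Both components lie below the join and hence below \<open>f\<close>, which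
      turns the reduction obtained into an equivalence.\<close>
    moreover have "g \<le>\<^sub>s\<^sub>u\<^sub>b\<^sub>T f" "h \<le>\<^sub>s\<^sub>u\<^sub>b\<^sub>T f"
      using equiv subT_le_of_join_le[of g h f] by (simp_all add: subT_equiv_def)
    ultimately show ?thesis by (auto simp: subT_equiv_def)
  qed
  ultimately show ?thesis by blast
qed

end
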